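(* Let $p$ be odd and let $p\times p$ denote the partition $(p,p,\dots,p)$ of $p^2$ (a $p\times p$ square). Then $$\mathrm{alt}(p\times p)=\mathrm{ralt}(p\times p)=\frac{E^p(E^2+2^2)^{p-1}(E^2+4^2)^{p-2}\cdots(E^2+(2(p-1))^2)}{H_{p\times p}},$$ where $H_{p\times p}$ is the product of the hook lengths of the $p\times p$ square and the right-hand side is evaluated umbrally.
   Context: For a standard Young tableau $T$ with $n$ entries, its descent set is $D(T)=\{i: i+1\text{ appears in a lower row than } i\}$; $T$ is alternating if $D(T)=\{1,3,5,\dots\}\cap[n-1]$ and reverse alternating if $D(T)=\{2,4,6,\dots\}\cap[n-1]$. $\mathrm{alt}(\lambda)$ and $\mathrm{ralt}(\lambda)$ are the numbers of alternating and reverse alternating SYT of shape $\lambda$. The numerator is $E^p\prod_{i=1}^{p-1}(E^2+(2i)^2)^{p-i}$. Euler numbers $E_n$: $\sum_{n\ge0}E_nx^n/n!=\sec x+\tan x$. Umbral evaluation: expand in powers of the indeterminate $E$, then replace each $E^k$ by $E_k$ as the last step. *)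

theory Defs
  imports
    "HOL-Library.FuncSet"
    "HOL-Computational_Algebra.Computational_Algebra"
begin

(* A partition is the list of its row lengths (weakly decreasing, positive).  Cells are
   pairs (row, column), numbered from 0 in English notation: row i + 1 lies below row i. *)

definition diagram :: "nat list \<Rightarrow> (nat \<times> nat) set" where
  "diagram lam = {(i, j). i < length lam \<and> j < lam ! i}"

(* Extensionality fixes the value of a tableau off the diagram, so that distinct functions
   in syt lam are distinct fillings and card counts fillings. *)
definition syt :: "nat list \<Rightarrow> (nat \<times> nat \<Rightarrow> nat) set" where
  "syt lam = {T \<in> extensional (diagram lam).
     bij_betw T (diagram lam) {1..sum_list lam} \<and>
     (\<forall>i j j'. (i, j) \<in> diagram lam \<and> (i, j') \<in> diagram lam \<and> j < j' \<longrightarrow> T (i, j) < T (i, j')) \<and>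
     (\<forall>i i' j. (i, j) \<in> diagram lam \<and> (i', j) \<in> diagram lam \<and> i < i' \<longrightarrow> T (i, j) < T (i', j))}"

definition descent_set :: "nat list \<Rightarrow> (nat \<times> nat \<Rightarrow> nat) \<Rightarrow> nat set" where
  "descent_set lam T = {k. \<exists>(i, j) \<in> diagram lam. \<exists>(i', j') \<in> diagram lam.
     T (i, j) = k \<and> T (i', j') = k + 1 \<and> i < i'}"

definition alternating :: "nat list \<Rightarrow> (nat \<times> nat \<Rightarrow> nat) \<Rightarrow> bool" where
  "alternating lam T \<longleftrightarrow> descent_set lam T = {k. odd k} \<inter> {1..<sum_list lam}"

definition reverse_alternating :: "nat list \<Rightarrow> (nat \<times> nat \<Rightarrow> nat) \<Rightarrow> bool" where
  "reverse_alternating lam T \<longleftrightarrow> descent_set lam T = {k. even k} \<inter> {1..<sum_list lam}"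

definition alt :: "nat list \<Rightarrow> nat" where
  "alt lam = card {T \<in> syt lam. alternating lam T}"

definition ralt :: "nat list \<Rightarrow> nat" where
  "ralt lam = card {T \<in> syt lam. reverse_alternating lam T}"

definition hook_length :: "nat list \<Rightarrow> nat \<times> nat \<Rightarrow> nat" where
  "hook_length lam = (\<lambda>(i, j). card {(i', j') \<in> diagram lam. i' = i \<and> j \<le> j' \<or> j' = j \<and> i \<le> i'})"

definition hook_product :: "nat list \<Rightarrow> nat" where
  "hook_product lam = (\<Prod>c \<in> diagram lam. hook_length lam c)"

definition square_shape :: "nat \<Rightarrow> nat list" where
  "square_shape p = replicate p p"

(* inverse (fps_cos 1) is the power series of sec x. *)
definition euler_number :: "nat \<Rightarrow> real" where
  "euler_number n = fact n * fps_nth (inverse (fps_cos 1) + fps_tan 1) n"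

definition umbral_eval :: "real poly \<Rightarrow> real" where
  "umbral_eval P = (\<Sum>k\<le>degree P. coeff P k * euler_number k)"

(* monom 1 1 is the indeterminate E. *)
definition square_numerator :: "nat \<Rightarrow> real poly" where
  "square_numerator p =
     monom 1 1 ^ p * (\<Prod>i\<in>{1..<p}. (monom 1 1 ^ 2 + [:(2 * real i)\<^sup>2:]) ^ (p - i))"

end

theory Submission
  imports Defs "Jordan_Normal_Form.Char_Poly"
begin

text \<open>
  Let \<open>h\<^sub>n(E)\<close> be the coefficients of \<open>exp (E arctan t)\<close> and let \<open>D(\<mu>)\<close> be the Jacobi--Trudi
  determinant of \<open>h\<close> at a partition \<open>\<mu>\<close>. The identity \<open>(sec x + tan x) cos x = 1 + sin x\<close> says how
  umbral evaluation behaves under \<open>E \<mapsto> E \<plusminus> i\<close>; since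
  \<open>(1 \<plusminus> i t) exp (E arctan t) = sqrt (1 + t\<^sup>2) exp ((E \<plusminus> i) arctan t)\<close>, this becomes a recursion for the
  umbral values of \<open>D(\<mu>)\<close> over the removal of vertical strips from \<open>\<mu>\<close>. The number of reverse
  alternating tableaux of shape \<open>\<mu>\<close>, encoded as ballot words, satisfies the same recursion when
  \<open>\<mu>\<close> has odd size, by a cancellation word by word. Hence it is the umbral value of \<open>D(\<mu>)\<close>.

  For the square, \<open>D\<close> is up to sign the Hankel determinant of \<open>h\<^sub>1, h\<^sub>2, \<dots>\<close>. These are moments
  of a functional \<open>L\<close> with the Pearson equation \<open>L ((1 + s\<^sup>2) f') = L ((E - 2 s) f)\<close>, whose orthogonal
  polynomials (of Jacobi type) come from a Rodrigues formula, and the determinant is the product of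
  their norms. Rotating a square tableau by a half turn and complementing its entries exchanges
  alternating and reverse alternating tableaux.
\<close>

hide_const (open) Module.smult

subsection \<open>The Hankel determinant of the arctangent polynomials\<close>

definition moment_functional :: "(nat \<Rightarrow> 'a::comm_ring_1) \<Rightarrow> 'a poly \<Rightarrow> 'a" where
  "moment_functional m f = (\<Sum>k\<le>degree f. coeff f k * m k)"

text \<open>Gives polynomials of different degrees a common summation range, after which linearity
  is termwise.\<close>

lemma moment_functional_eq:
  assumes "degree f \<le> N"
  shows "moment_functional m f = (\<Sum>k\<le>N. coeff f k * m k)"
  unfolding moment_functional_def
  by (rule sum.mono_neutral_left) (use assms in \<open>auto simp: coeff_eq_0 not_le\<close>)

lemma moment_functional_add:
  "moment_functional m (f + g) = moment_functional m f + moment_functional m g"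
proof -
  let ?N = "max (degree f) (degree g)"
  show ?thesis
    using degree_add_le_max[of f g]
    by (simp add: moment_functional_eq[of _ ?N] sum.distrib algebra_simps)
qed

lemma moment_functional_smult:
  "moment_functional m (smult c f) = c * moment_functional m f"
  using degree_smult_le[of c f]
  by (simp add: moment_functional_eq[of _ "degree f"] sum_distrib_left mult.assoc)

lemma moment_functional_0 [simp]: "moment_functional m 0 = 0"
  by (simp add: moment_functional_def)

lemma moment_functional_uminus: "moment_functional m (- f) = - moment_functional m f"
  using moment_functional_smult[of m "-1" f] by simp

lemma moment_functional_diff:
  "moment_functional m (f - g) = moment_functional m f - moment_functional m g"
  using moment_functional_add[of m f "- g"] by (simp add: moment_functional_uminus)

lemma moment_functional_sum:
  "moment_functional m (sum f A) = (\<Sum>x\<in>A. moment_functional m (f x))"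
  by (induction A rule: infinite_finite_induct) (auto simp: moment_functional_add)

lemma moment_functional_monom: "moment_functional m (monom c n) = c * m n"
proof -
  have "moment_functional m (monom c n) = (\<Sum>k\<le>n. coeff (monom c n) k * m k)"
    by (rule moment_functional_eq) (rule degree_monom_le)
  also have "\<dots> = c * m n"
    by (simp add: if_distrib[of "\<lambda>x. x * _"] sum.delta cong: if_cong)
  finally show ?thesis .
qed

text \<open>Serves for identities that are linear in the polynomial, such as \<open>pearson\<close>
  and \<open>umbral_shift\<close>: monomials then suffice.\<close>

lemma poly_add_monom_induct:
  assumes "\<And>c n. P (monom c n)" and "\<And>f g. P f \<Longrightarrow> P g \<Longrightarrow> P (f + g)"
  shows "P (f :: 'a::comm_ring_1 poly)"
proof -
  have "P (\<Sum>i\<le>n. monom (coeff f i) i)" for n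
    by (induction n) (auto intro: assms)
  then show ?thesis
    using poly_as_sum_of_monoms[of f] by metis
qed

text \<open>The generating function of \<open>atan_poly\<close> is \<open>exp (E arctan t)\<close>; the recursion is the differential
  equation \<open>(1 + t\<^sup>2) F' = E F\<close>.\<close>

fun atan_poly :: "nat \<Rightarrow> complex poly" where
  "atan_poly 0 = 1"
| "atan_poly (Suc 0) = [:0, 1:]"
| "atan_poly (Suc (Suc n)) =
     smult (1 / of_nat (n + 2)) ([:0, 1:] * atan_poly (Suc n) - smult (of_nat n) (atan_poly n))"

lemma atan_poly_eval_rec:
  "of_nat (n + 2) * poly (atan_poly (Suc (Suc n))) E
     = E * poly (atan_poly (Suc n)) E - of_nat n * poly (atan_poly n) E"
proof -
  have "(of_nat (n + 2) :: complex) \<noteq> 0"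
    by (metis add_is_0 of_nat_eq_0_iff zero_neq_numeral)
  then show ?thesis by (simp add: field_simps del: of_nat_add)
qed

section \<open>The functional at a fixed complex value of E: Pearson equation, Rodrigues
  polynomials, norms\<close>

locale atan_moments =
  fixes E :: complex
begin

text \<open>The shift by one matches the square: reversing the rows of its Jacobi-Trudi matrix gives
  the Hankel matrix that begins with \<open>h\<^sub>1\<close>.\<close>

definition m :: "nat \<Rightarrow> complex" where "m n = poly (atan_poly (Suc n)) E"

abbreviation L :: "complex poly \<Rightarrow> complex" where "L \<equiv> moment_functional m"

definition w :: "complex poly" where "w = [:1, 0, 1:]"

lemma m_0: "m 0 = E"
  by (simp add: m_def)

text \<open>\<open>atan_poly n\<close> stands in the place of \<open>m (n - 1)\<close>, so that n =
  0 is covered: there its coefficient is 0.\<close>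

lemma m_rec: "of_nat (n + 2) * m (Suc n) + of_nat n * poly (atan_poly n) E = E * m n"
  using atan_poly_eval_rec[of n E] by (simp add: m_def)

lemma w_mult_monom: "w * monom c n = monom c n + monom c (n + 2)"
  by (rule poly_eqI) (auto simp: w_def coeff_pCons split: nat.splits)

text \<open>The extra factor \<open>w\<close> restores the exponent, so no \<open>a - 1\<close>
  appears and a = 0 is included.\<close>

lemma w_pderiv_power: "w * pderiv (w ^ a) = smult (2 * of_nat a) ([:0, 1:] * w ^ a)"
proof (cases a)
  case (Suc i)
  have "w * pderiv (w ^ a) = smult (of_nat a) (w ^ a * pderiv w)"
    unfolding Suc pderiv_power_Suc by (simp only: mult_smult_left mult_smult_right power_Suc mult_ac)
  also have "pderiv w = smult 2 [:0, 1:]"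
    by (simp add: w_def pderiv_pCons)
  finally show ?thesis
    by (simp only: mult_smult_right smult_smult mult.commute)
qed simp

text \<open>By linearity only monomials \<open>s^n\<close> matter, and for them the equation is
  \<open>m_rec\<close>, the coefficient form of (1 + t^2) F' = E F.\<close>

lemma pearson: "L (w * pderiv f) = L ([:E, -2:] * f)"
proof (induction f rule: poly_add_monom_induct)
  case (2 f g)
  then show ?case by (simp only: pderiv_add distrib_left moment_functional_add)
next
  case (1 c n)
  have eq: "[:E, -2:] * monom c n = monom (E * c) n - monom (2 * c) (Suc n)"
    by (rule poly_eqI) (auto simp: coeff_pCons split: nat.splits)
  have rhs: "L ([:E, -2:] * monom c n) = c * (E * m n - 2 * m (Suc n))"
    unfolding eq by (simp add: moment_functional_diff moment_functional_monom algebra_simps)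
  show ?case
  proof (cases n)
    case 0
    then show ?thesis unfolding rhs using m_rec[of 0]
      by (simp add: pderiv_monom)
  next
    case (Suc k)
    have "L (w * pderiv (monom c n)) = of_nat n * c * (m k + m (k + 2))"
      unfolding pderiv_monom w_mult_monom using Suc
      by (simp add: moment_functional_add moment_functional_monom algebra_simps)
    also have "of_nat n * (m k + m (k + 2)) = E * m n - 2 * m (Suc n)"
    proof -
      have "of_nat (n + 2) * m (Suc n) + of_nat n * m k = E * m n"
        using m_rec[of n] Suc by (simp only: m_def)
      then show ?thesis using Suc by (simp add: algebra_simps)
    qed
    then have "of_nat n * c * (m k + m (k + 2)) = c * (E * m n - 2 * m (Suc n))"
      by (metis mult.assoc mult.commute)
    finally show ?thesis unfolding rhs .
  qed
qed

text \<open>If \<open>L\<close> is integration against a weight \<open>v\<close>, then \<open>- w\<^sup>j\<^sup>-\<^sup>1 v \<cdot> rodrigues_step j q\<close> is the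
  derivative of \<open>w\<^sup>j v q\<close>.\<close>

definition rodrigues_step :: "nat \<Rightarrow> complex poly \<Rightarrow> complex poly" where
  "rodrigues_step j q = [:E, - 2 * of_nat j:] * q - w * pderiv q"

text \<open>Integration by parts: \<open>pearson\<close> is applied to \<open>f * w ^ j * q\<close>
  and the product rule gives three terms. The one with \<open>pderiv f\<close> is isolated; the
  derivative of \<open>w ^ j\<close> turns the factor E - 2 s into E - 2 (j + 1) s.\<close>

lemma rodrigues_step_adjoint:
  "L (pderiv f * w ^ Suc j * q) = L (f * w ^ j * rodrigues_step (Suc j) q)"
proof -
  have pw: "w * pderiv (w ^ j) = [:0, 2 * of_nat j:] * w ^ j"
    by (simp add: w_pderiv_power)
  have "w * pderiv (f * w ^ j * q) = pderiv f * w ^ Suc j * q + f * q * (w * pderiv (w ^ j))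
          + f * w ^ j * (w * pderiv q)"
    by (simp only: pderiv_mult power_Suc ring_distribs mult_ac add_ac)
  then have "pderiv f * w ^ Suc j * q = w * pderiv (f * w ^ j * q)
      - f * q * ([:0, 2 * of_nat j:] * w ^ j) - f * w ^ j * (w * pderiv q)"
    unfolding pw by (simp only: algebra_simps)
  then have "L (pderiv f * w ^ Suc j * q)
     = L ([:E, -2:] * (f * w ^ j * q) - f * q * ([:0, 2 * of_nat j:] * w ^ j)
          - f * w ^ j * (w * pderiv q))"
    by (simp only: moment_functional_diff pearson)
  also have "[:E, -2:] * (f * w ^ j * q) - f * q * ([:0, 2 * of_nat j:] * w ^ j)
          - f * w ^ j * (w * pderiv q)
     = f * w ^ j * (([:E, -2:] - [:0, 2 * of_nat j:]) * q - w * pderiv q)"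
    by (simp only: algebra_simps)
  also have "[:E, -2:] - [:0, 2 * of_nat j:] = [:E, - 2 * of_nat (Suc j):]"
    by simp
  finally show ?thesis by (simp only: rodrigues_step_def)
qed

text \<open>In terms of a weight v, the d-th derivative of \<open>w^k v\<close> is
  \<open>(-1)^d w^(k-d) v\<close> times \<open>rodrigues k d\<close>. The diagonal
  \<open>rodrigues k k\<close> is the orthogonal polynomial of degree k.\<close>

fun rodrigues :: "nat \<Rightarrow> nat \<Rightarrow> complex poly" where
  "rodrigues k 0 = 1"
| "rodrigues k (Suc d) = rodrigues_step (k - d) (rodrigues k d)"

text \<open>Each step moves one derivative off f. For d = k all of them are moved, so
  \<open>rodrigues k k\<close> is orthogonal to every f of degree below k.\<close>

lemma rodrigues_adjoint:
  assumes "d \<le> k"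
  shows "L ((pderiv ^^ k) f * w ^ k)
       = L ((pderiv ^^ (k - d)) f * w ^ (k - d) * rodrigues k d)"
  using assms
proof (induction d)
  case (Suc d)
  then obtain e where e: "k - d = Suc e" "k - Suc d = e"
    by (metis Suc_diff_Suc Suc_le_lessD)
  show ?case using Suc rodrigues_step_adjoint[of "(pderiv ^^ e) f" e "rodrigues k d"] e
    by simp
qed simp

text \<open>The step with index j = k - d raises the degree by at most one. The linear factor
  contributes -2 j and the derivative term -d to the top coefficient, together -(2 k - d).\<close>

lemma coeff_rodrigues:
  assumes "d \<le> k"
  shows "degree (rodrigues k d) \<le> d \<and> coeff (rodrigues k d) d = (-1) ^ d * (\<Prod>e<d. of_nat (2 * k - e))"
  using assms
proof (induction d)
  case (Suc d)
  let ?q = "rodrigues k d"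
  have IH: "degree ?q \<le> d" "coeff ?q d = (-1) ^ d * (\<Prod>e<d. of_nat (2 * k - e))"
    using Suc by auto
  have "degree (rodrigues_step (k - d) ?q) \<le> Suc d"
    unfolding rodrigues_step_def
  proof (rule degree_diff_le)
    show "degree ([:E, - 2 * of_nat (k - d):] * ?q) \<le> Suc d"
      by (rule order_trans[OF degree_mult_le]) (use IH in auto)
    show "degree (w * pderiv ?q) \<le> Suc d"
    proof (cases "degree ?q = 0")
      case True
      then have "pderiv ?q = 0" by (simp add: pderiv_eq_0_iff)
      then show ?thesis by simp
    next
      case False
      then show ?thesis
        by (intro order_trans[OF degree_mult_le]) (use IH in \<open>auto simp: degree_pderiv w_def\<close>)
    qed
  qed
  moreover have "coeff (rodrigues_step (k - d) ?q) (Suc d) = - of_nat (2 * k - d) * coeff ?q d"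
  proof -
    have "coeff ?q (Suc d) = 0" "coeff ?q (Suc (Suc d)) = 0"
      using IH(1) by (auto intro: coeff_eq_0)
    moreover have "(of_nat (2 * k - d) :: complex) = 2 * of_nat (k - d) + of_nat d"
    proof -
      have "2 * k - d = 2 * (k - d) + d" using Suc.prems by simp
      then show ?thesis by (metis of_nat_add of_nat_mult of_nat_numeral)
    qed
    moreover have "coeff (rodrigues_step j q) (Suc d) = - (2 * of_nat j + of_nat d) * coeff q d"
      if "coeff q (Suc d) = 0" "coeff q (Suc (Suc d)) = 0" for q j
      using that
      by (cases d) (simp_all add: w_def rodrigues_step_def coeff_pCons coeff_pderiv algebra_simps)
    ultimately show ?thesis by simp
  qed
  ultimately show ?case using IH(2) by simp
qed simp

text \<open>\<open>pearson\<close> for \<open>w ^ a\<close> and for \<open>s * w ^ a\<close> gives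
  two relations; eliminating \<open>L (s * w ^ a)\<close> leaves a two-term recursion from
  \<open>L (w ^ a)\<close> to \<open>L (w ^ Suc a)\<close>.\<close>

lemma L_w_power: "L (w ^ a) = E * (\<Prod>j=1..a. E\<^sup>2 + (2 * of_nat j)\<^sup>2) / fact (2 * a + 1)"
proof (induction a)
  case 0
  have "L 1 = m 0" using moment_functional_monom[of m 1 0] by simp
  then show ?case by (simp add: m_0)
next
  case (Suc a)
  let ?s = "[:0, 1:] :: complex poly"
  note pw = w_pderiv_power[of a]
  have E2: "[:E, -2:] * f = smult E f - smult 2 (?s * f)" for f
    by simp
  have "L (w * pderiv (w ^ a)) = L ([:E, -2:] * w ^ a)" by (rule pearson)
  then have J: "(2 * of_nat a + 2) * L (?s * w ^ a) = E * L (w ^ a)"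
    unfolding pw E2 moment_functional_diff moment_functional_smult
    by (simp only: algebra_simps)
  \<comment> \<open>Rewriting s^2 as w - 1 keeps everything in terms of powers of w, with at most
    one factor s.\<close>
  have s2: "?s * ?s = w - 1" by (simp add: one_pCons w_def)
  have "w * pderiv (?s * w ^ a) = w ^ Suc a + ?s * (w * pderiv (w ^ a))"
    by (simp add: pderiv_mult pderiv_pCons one_pCons[symmetric] algebra_simps del: mult_pCons_left mult_pCons_right)
  also have "\<dots> = w ^ Suc a + smult (2 * of_nat a) ((?s * ?s) * w ^ a)"
    unfolding pw by (simp only: mult_smult_right mult.assoc)
  also have "\<dots> = w ^ Suc a + smult (2 * of_nat a) (w ^ Suc a - w ^ a)"
    unfolding s2 by (simp only: left_diff_distrib power_Suc mult_1_left)
  finally have l: "L (w * pderiv (?s * w ^ a)) = L (w ^ Suc a) + 2 * of_nat a * (L (w ^ Suc a) - L (w ^ a))"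
    by (simp only: moment_functional_diff moment_functional_add moment_functional_smult)
  have "[:E, -2:] * (?s * w ^ a) = smult E (?s * w ^ a) - smult 2 ((?s * ?s) * w ^ a)"
    unfolding E2 by (simp only: mult.assoc)
  also have "\<dots> = smult E (?s * w ^ a) - smult 2 (w ^ Suc a - w ^ a)"
    unfolding s2 by (simp only: left_diff_distrib power_Suc mult_1_left)
  finally have r: "L ([:E, -2:] * (?s * w ^ a)) = E * L (?s * w ^ a) - 2 * (L (w ^ Suc a) - L (w ^ a))"
    by (simp only: moment_functional_diff moment_functional_add moment_functional_smult)
  have "(2 * of_nat a + 3) * L (w ^ Suc a) = (2 * of_nat a + 2) * L (w ^ a) + E * L (?s * w ^ a)"
  proof -
    have "(2 * n + 3) * x = (2 * n + 2) * y + z"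
      if "x + 2 * n * (x - y) = z - 2 * (x - y)" for n x y z :: complex
    proof -
      have "(2 * n + 3) * x - ((2 * n + 2) * y + z) = (x + 2 * n * (x - y)) - (z - 2 * (x - y))"
        by (simp add: algebra_simps)
      then show ?thesis using that by simp
    qed
    then show ?thesis using l r pearson[of "?s * w ^ a"] by presburger
  qed
  then have "(2 * of_nat a + 2) * ((2 * of_nat a + 3) * L (w ^ Suc a))
      = (2 * of_nat a + 2)\<^sup>2 * L (w ^ a) + E * ((2 * of_nat a + 2) * L (?s * w ^ a))"
    by (simp add: power2_eq_square ring_distribs mult_ac del: mult_pCons_left mult_pCons_right)
  then have R: "(2 * of_nat a + 2) * ((2 * of_nat a + 3) * L (w ^ Suc a))
      = (E\<^sup>2 + (2 * of_nat (Suc a))\<^sup>2) * L (w ^ a)"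
    unfolding J by (simp add: power2_eq_square algebra_simps)
  have nz: "(2 * of_nat a + 2 :: complex) \<noteq> 0" "(2 * of_nat a + 3 :: complex) \<noteq> 0"
    using of_nat_neq_0[of "2 * a + 1", where 'a = complex] of_nat_neq_0[of "2 * a + 2", where 'a = complex]
    by (simp_all add: algebra_simps)
  have f: "(fact (2 * Suc a + 1) :: complex) = (2 * of_nat a + 2) * ((2 * of_nat a + 3) * fact (2 * a + 1))"
    by (simp add: algebra_simps)
  have p: "(\<Prod>j=1..Suc a. E\<^sup>2 + (2 * of_nat j)\<^sup>2) = (E\<^sup>2 + (2 * of_nat (Suc a))\<^sup>2) * (\<Prod>j=1..a. E\<^sup>2 + (2 * of_nat j)\<^sup>2)"
    by (rule prod.nat_ivl_Suc') simp
  have "L (w ^ Suc a) = ((E\<^sup>2 + (2 * of_nat (Suc a))\<^sup>2) * L (w ^ a)) / ((2 * of_nat a + 2) * (2 * of_nat a + 3))"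
    unfolding R[symmetric] using nz by (simp del: power_Suc of_nat_Suc)
  then show ?case
    unfolding Suc.IH f p
    by (simp only: times_divide_eq_right times_divide_eq_left divide_divide_eq_left mult_ac)
qed

lemma pderiv_iter_monom: "j \<le> k \<Longrightarrow> (pderiv ^^ k) (monom 1 j :: complex poly) = (if j < k then 0 else [:fact k:])"
proof (induction k arbitrary: j)
  case (Suc k)
  have z: "(pderiv ^^ n) (0 :: complex poly) = 0" for n by (induction n) auto
  have sm: "(pderiv ^^ n) (smult c f :: complex poly) = smult c ((pderiv ^^ n) f)" for n c f
    by (induction n) (auto simp: pderiv_smult)
  show ?case
  proof (cases j)
    case 0
    then show ?thesis by (simp add: funpow_Suc_right z pderiv_monom del: funpow.simps)
  next
    case (Suc i)
    have "pderiv (monom 1 j :: complex poly) = smult (of_nat j) (monom 1 i)"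
      using Suc by (simp add: pderiv_monom smult_monom)
    then show ?thesis using Suc.IH[of i] Suc.prems Suc
      by (auto simp: funpow_Suc_right sm simp del: funpow.simps)
  qed
qed (simp add: one_pCons monom_0)

text \<open>Identifies the leading coefficient of \<open>rodrigues k k\<close>, up to sign, as (2
  k)! / k!.\<close>

lemma prod_falling: "(\<Prod>e<k. of_nat (2 * k - e)) * fact k = (fact (2 * k) :: complex)"
proof -
  have "d \<le> n \<Longrightarrow> (\<Prod>e<d. of_nat (n - e)) * fact (n - d) = (fact n :: complex)" for d n :: nat
  proof (induction d)
    case (Suc d)
    then have "(fact (n - d) :: complex) = of_nat (n - d) * fact (n - Suc d)"
      by (metis Suc_diff_Suc Suc_le_lessD fact_Suc)
    then show ?case using Suc by (simp add: mult.assoc)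
  qed simp
  from this[of k "2 * k"] show ?thesis by simp
qed

text \<open>With C the matrix of coefficients of the orthogonal polynomials, C M has the entries
  \<open>L (rodrigues i i * s^j)\<close>. C is lower triangular by degree and C M is upper
  triangular by orthogonality, so the determinant of M is a quotient of two diagonal
  products.\<close>

lemma hankel_det:
  "det (mat p p (\<lambda>(i, j). m (i + j))) =
     (\<Prod>k<p. (-1) ^ k * (fact k)\<^sup>2 / (fact (2 * k) * fact (2 * k + 1)) *
        (E * (\<Prod>j=1..k. E\<^sup>2 + (2 * of_nat j)\<^sup>2)))"
proof -
  define M where "M = mat p p (\<lambda>(i, j). m (i + j))"
  define C where "C = mat p p (\<lambda>(i, j). coeff (rodrigues i i) j)"
  define N where "N = mat p p (\<lambda>(i, j). L (rodrigues i i * monom 1 j))"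
  have C: "C \<in> carrier_mat p p" and M: "M \<in> carrier_mat p p" and N: "N \<in> carrier_mat p p"
    by (auto simp: C_def M_def N_def)
  have deg: "degree (rodrigues i i) \<le> i" for i using coeff_rodrigues[of i i] by simp
  have CM: "C * M = N"
  proof (rule eq_matI)
    fix i j assume "i < dim_row N" "j < dim_col N"
    then have ij: "i < p" "j < p" by (auto simp: N_def)
    have "rodrigues i i * monom 1 j = (\<Sum>k\<le>degree (rodrigues i i). monom (coeff (rodrigues i i) k) k) * monom 1 j"
      by (simp only: poly_as_sum_of_monoms)
    also have "\<dots> = (\<Sum>k\<le>degree (rodrigues i i). monom (coeff (rodrigues i i) k) (k + j))"
      by (simp add: sum_distrib_right mult_monom)
    finally have "L (rodrigues i i * monom 1 j) = (\<Sum>k\<le>degree (rodrigues i i). coeff (rodrigues i i) k * m (k + j))"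
      by (simp add: moment_functional_sum moment_functional_monom)
    also have "\<dots> = (\<Sum>k<p. coeff (rodrigues i i) k * m (k + j))"
      by (rule sum.mono_neutral_left) (use ij deg[of i] in \<open>auto simp: coeff_eq_0 not_le\<close>)
    finally show "(C * M) $$ (i, j) = N $$ (i, j)"
      using ij by (simp add: C_def M_def N_def scalar_prod_def atLeast0LessThan)
  qed (auto simp: C_def M_def N_def)
  \<comment> \<open>All k derivatives fall on \<open>s^j\<close>: they kill it for j < k and leave
    k! for j = k.\<close>
  have Lmon: "L (rodrigues k k * monom 1 j) = (if j < k then 0 else fact k * L (w ^ k))"
    if "j \<le> k" for j k
  proof -
    have "L (rodrigues k k * monom 1 j) = L ((pderiv ^^ k) (monom 1 j) * w ^ k)"
      using rodrigues_adjoint[of k k "monom 1 j"] by (simp add: mult.commute)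
    also have "\<dots> = (if j < k then 0 else fact k * L (w ^ k))"
      using that by (auto simp: pderiv_iter_monom moment_functional_smult)
    finally show ?thesis .
  qed
  have "det N = prod_list (diag_mat N)"
    by (rule det_upper_triangular[OF _ N]) (auto simp: upper_triangular_def N_def Lmon)
  also have "\<dots> = (\<Prod>k<p. fact k * L (w ^ k))"
    by (auto simp: prod_list_diag_prod N_def Lmon atLeast0LessThan intro!: prod.cong)
  finally have dN: "det N = (\<Prod>k<p. fact k * L (w ^ k))" .
  have "det C = prod_list (diag_mat C)"
    by (rule det_lower_triangular[OF _ C])
       (auto simp: C_def intro!: coeff_eq_0 le_less_trans[OF deg])
  also have "\<dots> = (\<Prod>k<p. (-1) ^ k * (\<Prod>e<k. of_nat (2 * k - e)))"
    by (auto simp: prod_list_diag_prod C_def coeff_rodrigues atLeast0LessThan intro!: prod.cong)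
  finally have dC: "det C = (\<Prod>k<p. (-1) ^ k * (\<Prod>e<k. of_nat (2 * k - e)))" .
  have nz: "(-1) ^ k * (\<Prod>e<k. of_nat (2 * k - e)) \<noteq> (0::complex)" for k
  proof -
    have "(\<Prod>e<k. of_nat (2 * k - e)) \<noteq> (0::complex)"
      using prod_falling[of k] by (metis fact_nonzero mult_zero_left)
    then show ?thesis by (simp del: prod_zero_iff)
  qed
  have "det M = det N / det C"
    using det_mult[OF C M] nz unfolding CM dC by (simp add: field_simps)
  also have "\<dots> = (\<Prod>k<p. fact k * L (w ^ k) / ((-1) ^ k * (\<Prod>e<k. of_nat (2 * k - e))))"
    unfolding dN dC by (simp add: prod_dividef)
  also have "\<dots> = (\<Prod>k<p. (-1) ^ k * (fact k)\<^sup>2 / (fact (2 * k) * fact (2 * k + 1)) *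
        (E * (\<Prod>j=1..k. E\<^sup>2 + (2 * of_nat j)\<^sup>2)))"
  proof (intro prod.cong refl)
    fix k
    have *: "(\<Prod>e<k. of_nat (2 * k - e)) = (fact (2 * k) / fact k :: complex)"
      using prod_falling[of k] by (simp add: field_simps)
    have "x / (-1) ^ k = (-1) ^ k * x" for x :: complex
      by (cases "even k") auto
    then have **: "x / ((-1) ^ k * y) = (-1) ^ k * x / y" for x y :: complex
      by (metis divide_divide_eq_left)
    show "fact k * L (w ^ k) / ((-1) ^ k * (\<Prod>e<k. of_nat (2 * k - e))) =
       (-1) ^ k * (fact k)\<^sup>2 / (fact (2 * k) * fact (2 * k + 1)) *
        (E * (\<Prod>j=1..k. E\<^sup>2 + (2 * of_nat j)\<^sup>2))"
      unfolding * ** L_w_power by (simp add: power2_eq_square mult_ac)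
  qed
  finally show ?thesis unfolding M_def .
qed

end

subsection \<open>Umbral evaluation\<close>

text \<open>\<open>cos_sign k\<close> and \<open>sin_sign k\<close> are the real and imaginary parts
  of \<open>\<i> ^ k\<close>, equivalently k! times the coefficients of cosine and sine.\<close>

definition cos_sign :: "nat \<Rightarrow> real" where
  "cos_sign k = (if even k then (-1) ^ (k div 2) else 0)"

definition sin_sign :: "nat \<Rightarrow> real" where
  "sin_sign k = (if odd k then (-1) ^ (k div 2) else 0)"

lemma i_power: "\<i> ^ k = of_real (cos_sign k) + \<i> * of_real (sin_sign k)"
proof -
  consider m where "k = 2 * m" | m where "k = Suc (2 * m)" by (metis oddE evenE Suc_eq_plus1)
  then show ?thesis by cases (auto simp: cos_sign_def sin_sign_def power_mult)
qed

lemma neg_i_power: "(- \<i>) ^ k = of_real (cos_sign k) - \<i> * of_real (sin_sign k)"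
proof -
  have "(- \<i>) ^ k = cnj (\<i> ^ k)" by simp
  then show ?thesis by (simp add: i_power)
qed

text \<open>This is n! times the n-th coefficient of (sec x + tan x) cos x = 1 + sin x.\<close>

lemma euler_cos_convolution:
  "(\<Sum>k\<le>n. real (n choose k) * euler_number k * cos_sign (n - k)) = of_bool (n = 0) + sin_sign n"
proof -
  define F :: "real fps" where "F = inverse (fps_cos 1) + fps_tan 1"
  have c0: "fps_nth (fps_cos (1::real)) 0 \<noteq> 0" by simp
  have "F * fps_cos 1 = inverse (fps_cos 1) * fps_cos 1 + fps_sin 1 * (inverse (fps_cos 1) * fps_cos 1)"
    unfolding F_def fps_tan_def by (simp add: fps_divide_unit distrib_right mult.assoc)
  then have "F * fps_cos 1 = 1 + fps_sin 1"
    by (simp add: inverse_mult_eq_1[OF c0])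
  then have "fps_nth (F * fps_cos 1) n = of_bool (n = 0) + fps_nth (fps_sin 1) n"
    by simp
  then have "(\<Sum>k\<le>n. fps_nth F k * fps_nth (fps_cos 1) (n - k)) = of_bool (n = 0) + fps_nth (fps_sin 1) n"
    by (simp add: fps_mult_nth atLeast0AtMost)
  then have "fact n * (\<Sum>k\<le>n. fps_nth F k * fps_nth (fps_cos 1) (n - k))
      = fact n * (of_bool (n = 0) + fps_nth (fps_sin 1) n)" by simp
  also have "\<dots> = of_bool (n = 0) + sin_sign n"
    by (auto simp: sin_sign_def fps_sin_def distrib_left elim!: oddE)
  also have "fact n * (\<Sum>k\<le>n. fps_nth F k * fps_nth (fps_cos 1) (n - k)) =
     (\<Sum>k\<le>n. real (n choose k) * euler_number k * cos_sign (n - k))"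
    unfolding sum_distrib_left
  proof (intro sum.cong refl)
    fix k assume "k \<in> {..n}"
    then have "real (n choose k) = fact n / (fact k * fact (n - k))"
      by (intro binomial_fact) simp
    then show "fact n * (fps_nth F k * fps_nth (fps_cos 1) (n - k)) =
         real (n choose k) * euler_number k * cos_sign (n - k)"
      by (simp add: euler_number_def F_def cos_sign_def fps_cos_def)
  qed
  finally show ?thesis .
qed

text \<open>Umbral evaluation over the complex numbers, where E can be shifted by
  \<open>\<i>\<close>.\<close>

definition umbral :: "complex poly \<Rightarrow> complex" where
  "umbral = moment_functional (\<lambda>k. of_real (euler_number k))"

lemma umbral_linear_power:
  "umbral ([:a, 1:] ^ n) = (\<Sum>k\<le>n. of_nat (n choose k) * a ^ (n - k) * of_real (euler_number k))"
proof -
  have "[:a, 1:] = monom 1 1 + [:a:]" by (simp add: monom_altdef)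
  then have "[:a, 1:] ^ n = (\<Sum>k\<le>n. of_nat (n choose k) * monom 1 1 ^ k * [:a:] ^ (n - k))"
    by (simp only: binomial_ring)
  also have "\<dots> = (\<Sum>k\<le>n. monom (of_nat (n choose k) * a ^ (n - k)) k)"
    by (intro sum.cong refl)
       (simp add: monom_power of_nat_poly poly_const_pow smult_monom mult_ac)
  finally show ?thesis
    by (simp add: umbral_def moment_functional_sum moment_functional_monom)
qed

text \<open>By linearity P may be taken as E^n, and then this is twice
  \<open>euler_cos_convolution\<close>: the summand for n = 0 becomes the value at 0, and
  \<open>sin_sign n\<close> becomes the difference quotient at \<open>\<i>\<close> and
  \<open>-\<i>\<close>.\<close>

lemma umbral_shift:
  "umbral (P \<circ>\<^sub>p [:\<i>, 1:]) + umbral (P \<circ>\<^sub>p [:-\<i>, 1:])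
     = 2 * poly P 0 + (poly P \<i> - poly P (-\<i>)) / \<i>"
proof (induction P rule: poly_add_monom_induct)
  case (2 f g)
  have "umbral ((f + g) \<circ>\<^sub>p [:\<i>, 1:]) + umbral ((f + g) \<circ>\<^sub>p [:-\<i>, 1:])
     = (umbral (f \<circ>\<^sub>p [:\<i>, 1:]) + umbral (f \<circ>\<^sub>p [:-\<i>, 1:]))
      + (umbral (g \<circ>\<^sub>p [:\<i>, 1:]) + umbral (g \<circ>\<^sub>p [:-\<i>, 1:]))"
    by (simp add: pcompose_add umbral_def moment_functional_add)
  then show ?case unfolding 2 by (simp add: algebra_simps)
next
  case (1 c n)
  have pc: "umbral (monom c n \<circ>\<^sub>p [:a, 1:]) = c * umbral ([:a, 1:] ^ n)" for a
  proof -
    have "monom c n \<circ>\<^sub>p [:a, 1:] = smult c ([:a, 1:] ^ n)"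
      by (rule poly_ext) (simp add: poly_pcompose poly_monom)
    then show ?thesis by (simp add: umbral_def moment_functional_smult)
  qed
  \<comment> \<open>In the sum of the two conjugate expansions the imaginary parts of
    \<open>\<i> ^ (n - k)\<close> cancel and the real parts double.\<close>
  have "umbral ([:\<i>, 1:] ^ n) + umbral ([:-\<i>, 1:] ^ n)
     = 2 * of_real (\<Sum>k\<le>n. real (n choose k) * euler_number k * cos_sign (n - k))"
    unfolding umbral_linear_power i_power neg_i_power
    by (simp add: algebra_simps sum.distrib sum_subtractf sum_distrib_left)
  also have "\<dots> = 2 * of_bool (n = 0) + (\<i> ^ n - (-\<i>) ^ n) / \<i>"
    unfolding euler_cos_convolution by (simp add: i_power neg_i_power)
  finally have "umbral (monom c n \<circ>\<^sub>p [:\<i>, 1:]) + umbral (monom c n \<circ>\<^sub>p [:-\<i>, 1:])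
     = c * (2 * of_bool (n = 0) + (\<i> ^ n - (-\<i>) ^ n) / \<i>)"
    unfolding pc by (simp add: distrib_left[symmetric])
  then show ?case
    by (auto simp: poly_monom algebra_simps diff_divide_distrib power_0_left)
qed

subsection \<open>Jacobi--Trudi determinants\<close>

text \<open>Integer arguments allow indices below zero, where \<open>atan_coeff\<close> is 0, and
  integer-valued \<open>\<mu>\<close> allows a cell to be taken from an empty row.\<close>

definition jacobi_trudi :: "nat \<Rightarrow> (int \<Rightarrow> 'a::comm_ring_1) \<Rightarrow> (nat \<Rightarrow> int) \<Rightarrow> 'a" where
  "jacobi_trudi p f \<mu> = det (mat p p (\<lambda>(i, j). f (\<mu> i - int i + int j)))"

definition remove_strip :: "(nat \<Rightarrow> int) \<Rightarrow> nat set \<Rightarrow> nat \<Rightarrow> int" where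
  "remove_strip \<mu> S i = \<mu> i - of_bool (i \<in> S)"

definition dominant :: "nat \<Rightarrow> (nat \<Rightarrow> int) \<Rightarrow> bool" where
  "dominant p \<mu> \<longleftrightarrow> (\<forall>i<p. 0 \<le> \<mu> i) \<and> (\<forall>i. Suc i < p \<longrightarrow> \<mu> (Suc i) \<le> \<mu> i)"

lemma jacobi_trudi_leibniz:
  "jacobi_trudi p f \<mu> =
     (\<Sum>\<sigma> | \<sigma> permutes {0..<p}. signof \<sigma> * (\<Prod>i=0..<p. f (\<mu> i - int i + int (\<sigma> i))))"
proof -
  have "jacobi_trudi p f \<mu> = (\<Sum>\<sigma> | \<sigma> permutes {0..<p}. signof \<sigma> *
     (\<Prod>i=0..<p. mat p p (\<lambda>(i, j). f (\<mu> i - int i + int j)) $$ (i, \<sigma> i)))"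
    unfolding jacobi_trudi_def by (rule det_def') simp
  also have "\<dots> = (\<Sum>\<sigma> | \<sigma> permutes {0..<p}. signof \<sigma> * (\<Prod>i=0..<p. f (\<mu> i - int i + int (\<sigma> i))))"
  proof (intro sum.cong refl arg_cong2[where f = "(*)"] prod.cong)
    fix \<sigma> i assume "\<sigma> \<in> {\<sigma>. \<sigma> permutes {0..<p}}" "i \<in> {0..<p}"
    then have "\<sigma> i < p" "i < p" using permutes_in_image[of \<sigma> "{0..<p}" i] by auto
    then show "mat p p (\<lambda>(i, j). f (\<mu> i - int i + int j)) $$ (i, \<sigma> i) = f (\<mu> i - int i + int (\<sigma> i))"
      by simp
  qed
  finally show ?thesis .
qed

text \<open>Multilinearity in the rows: S collects the rows in which the second summand is chosen,
  and replacing n by n - 1 in row i amounts to lowering \<open>\<mu> i\<close> by one.\<close>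

lemma jacobi_trudi_add_shift:
  "jacobi_trudi p (\<lambda>n. f n + c * f (n - 1)) \<mu> =
     (\<Sum>S\<in>Pow {0..<p}. c ^ card S * jacobi_trudi p f (remove_strip \<mu> S))"
proof -
  have *: "(\<Prod>i=0..<p. f (\<mu> i - int i + int (\<sigma> i)) + c * f (\<mu> i - int i + int (\<sigma> i) - 1)) =
    (\<Sum>S\<in>Pow {0..<p}. c ^ card S * (\<Prod>i=0..<p. f (remove_strip \<mu> S i - int i + int (\<sigma> i))))" for \<sigma>
  proof -
    have "(\<Prod>i=0..<p. c * f (\<mu> i - int i + int (\<sigma> i) - 1) + f (\<mu> i - int i + int (\<sigma> i))) =
      (\<Sum>S\<in>Pow {0..<p}. (\<Prod>i\<in>S. c * f (\<mu> i - int i + int (\<sigma> i) - 1)) *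
         (\<Prod>i\<in>{0..<p} - S. f (\<mu> i - int i + int (\<sigma> i))))"
      by (rule prod_add) simp
    also have "\<dots> = (\<Sum>S\<in>Pow {0..<p}. c ^ card S * (\<Prod>i=0..<p. f (remove_strip \<mu> S i - int i + int (\<sigma> i))))"
    proof (rule sum.cong[OF refl])
      fix S assume S: "S \<in> Pow {0..<p}"
      have "(\<Prod>i=0..<p. f (remove_strip \<mu> S i - int i + int (\<sigma> i))) =
        (\<Prod>i\<in>S. f (remove_strip \<mu> S i - int i + int (\<sigma> i))) *
        (\<Prod>i\<in>{0..<p} - S. f (remove_strip \<mu> S i - int i + int (\<sigma> i)))"
        using S by (subst prod.subset_diff[of S]) (auto simp: mult.commute)
      also have "(\<Prod>i\<in>S. f (remove_strip \<mu> S i - int i + int (\<sigma> i))) =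
         (\<Prod>i\<in>S. f (\<mu> i - int i + int (\<sigma> i) - 1))"
        by (rule prod.cong) (auto simp: remove_strip_def algebra_simps)
      also have "(\<Prod>i\<in>{0..<p} - S. f (remove_strip \<mu> S i - int i + int (\<sigma> i))) =
         (\<Prod>i\<in>{0..<p} - S. f (\<mu> i - int i + int (\<sigma> i)))"
        by (rule prod.cong) (auto simp: remove_strip_def)
      finally show "(\<Prod>i\<in>S. c * f (\<mu> i - int i + int (\<sigma> i) - 1)) *
         (\<Prod>i\<in>{0..<p} - S. f (\<mu> i - int i + int (\<sigma> i)))
         = c ^ card S * (\<Prod>i=0..<p. f (remove_strip \<mu> S i - int i + int (\<sigma> i)))"
        by (simp add: prod.distrib mult.assoc)
    qed
    finally show ?thesis by (simp only: add.commute)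
  qed
  show ?thesis
    unfolding jacobi_trudi_leibniz *
    by (simp add: sum_distrib_left mult_ac) (rule sum.swap)
qed

lemma jacobi_trudi_row_0:
  assumes k: "k < p" and z: "\<And>j. j < p \<Longrightarrow> f (\<mu> k - int k + int j) = 0"
  shows "jacobi_trudi p f \<mu> = 0"
  unfolding jacobi_trudi_leibniz
proof (rule sum.neutral, rule ballI)
  fix \<sigma> assume s: "\<sigma> \<in> {\<sigma>. \<sigma> permutes {0..<p}}"
  then have "\<sigma> k < p" using permutes_in_image[of \<sigma> "{0..<p}" k] k by auto
  then have "f (\<mu> k - int k + int (\<sigma> k)) = 0" by (rule z)
  then have "(\<Prod>i=0..<p. f (\<mu> i - int i + int (\<sigma> i))) = 0"
    using k by (intro prod_zero) (auto intro!: bexI[of _ k])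
  then show "signof \<sigma> * (\<Prod>i=0..<p. f (\<mu> i - int i + int (\<sigma> i))) = 0" by simp
qed

text \<open>If the order breaks, it breaks by exactly one between consecutive rows, which makes
  these two rows of the matrix equal. Otherwise the last entry is negative, and the last row of the
  matrix has only negative arguments.\<close>

lemma jacobi_trudi_not_dominant:
  assumes f: "\<And>n. n < 0 \<Longrightarrow> f n = 0" and d: "dominant p \<mu>"
    and nd: "\<not> dominant p (remove_strip \<mu> S)"
  shows "jacobi_trudi p f (remove_strip \<mu> S) = 0"
proof (cases "\<exists>i. Suc i < p \<and> remove_strip \<mu> S i < remove_strip \<mu> S (Suc i)")
  case True
  then obtain i where i: "Suc i < p" "remove_strip \<mu> S i < remove_strip \<mu> S (Suc i)" by auto
  then have eq: "remove_strip \<mu> S (Suc i) = remove_strip \<mu> S i + 1"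
    using d unfolding dominant_def remove_strip_def by (auto split: if_splits simp: of_bool_def)
  show ?thesis unfolding jacobi_trudi_def
    by (rule det_identical_rows[of _ p i "Suc i"]) (use i eq in \<open>auto simp: algebra_simps\<close>)
next
  case False
  then have "\<not> (\<forall>i<p. 0 \<le> remove_strip \<mu> S i)" using nd unfolding dominant_def by force
  then obtain i where i: "i < p" "remove_strip \<mu> S i < 0" by (auto simp: not_le)
  have "k < p \<Longrightarrow> i \<le> k \<Longrightarrow> remove_strip \<mu> S k \<le> remove_strip \<mu> S i" for k
  proof (induction k)
    case (Suc k)
    have "remove_strip \<mu> S (Suc k) \<le> remove_strip \<mu> S k"
      using False Suc.prems by (meson not_less)
    then show ?case using Suc by (cases "i = Suc k") auto
  qed auto
  from this[of "p - 1"] have neg: "remove_strip \<mu> S (p - 1) < 0" using i by linarith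
  show ?thesis
    by (rule jacobi_trudi_row_0[of "p - 1"]) (use i neg in \<open>auto intro!: f\<close>)
qed

text \<open>For \<open>\<mu>\<close> = 0 the matrix is the identity. Otherwise
  \<open>\<mu> 0\<close> is positive by dominance, and all arguments in row 0 are positive.\<close>

lemma jacobi_trudi_delta:
  assumes "dominant p \<mu>"
  shows "jacobi_trudi p (\<lambda>n. of_bool (n = 0)) \<mu> = of_bool (\<forall>i<p. \<mu> i = 0)"
proof (cases "\<forall>i<p. \<mu> i = 0")
  case True
  have "mat p p (\<lambda>(i, j). of_bool (\<mu> i - int i + int j = 0)) = (1\<^sub>m p :: 'a mat)"
    by (rule eq_matI) (use True in auto)
  then show ?thesis using True unfolding jacobi_trudi_def by simp
next
  case False
  then obtain i where i: "i < p" "\<mu> i > 0" using assms unfolding dominant_def by force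
  have "k \<le> i \<Longrightarrow> \<mu> i \<le> \<mu> (i - k)" for k
  proof (induction k)
    case (Suc k)
    then have "\<mu> (i - k) \<le> \<mu> (i - Suc k)"
      using assms i(1) unfolding dominant_def
      by (metis Suc_diff_Suc Suc_le_lessD diff_le_self le_less_trans)
    then show ?case using Suc by auto
  qed auto
  from this[of i] have "\<mu> 0 > 0" using i by auto
  then have "jacobi_trudi p (\<lambda>n. of_bool (n = 0)) \<mu> = (0 :: 'a)"
    using i by (intro jacobi_trudi_row_0[of 0]) auto
  then show ?thesis using False by simp
qed

lemma poly_jacobi_trudi: "poly (jacobi_trudi p f \<mu>) x = jacobi_trudi p (\<lambda>n. poly (f n) x) \<mu>"
  unfolding jacobi_trudi_leibniz
  by (simp add: poly_sum poly_prod sign_def if_distrib[of "\<lambda>q. poly q x"])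

lemma pcompose_jacobi_trudi: "jacobi_trudi p f \<mu> \<circ>\<^sub>p q = jacobi_trudi p (\<lambda>n. f n \<circ>\<^sub>p q) \<mu>"
  unfolding jacobi_trudi_leibniz
  by (auto simp: pcompose_sum pcompose_prod pcompose_mult sign_def pcompose_uminus pcompose_1 intro!: sum.cong)

section \<open>The coefficient polynomials, their shift identity and the resulting recursion\<close>

definition atan_coeff :: "int \<Rightarrow> complex poly" where
  "atan_coeff n = (if n < 0 then 0 else atan_poly (nat n))"

text \<open>The generating function of \<open>sec_atan_poly\<close> is \<open>sqrt (1 + t\<^sup>2) exp (E arctan t)\<close>.\<close>

fun sec_atan_poly :: "nat \<Rightarrow> complex poly" where
  "sec_atan_poly 0 = 1"
| "sec_atan_poly (Suc 0) = [:0, 1:]"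
| "sec_atan_poly (Suc (Suc n)) = smult (1 / of_nat (n + 2))
     ([:0, 1:] * sec_atan_poly (Suc n) - smult (of_nat n - 1) (sec_atan_poly n))"

definition sec_atan_coeff :: "int \<Rightarrow> complex poly" where
  "sec_atan_coeff n = (if n < 0 then 0 else sec_atan_poly (nat n))"

lemma sec_atan_poly_eval_rec:
  "of_nat (n + 2) * poly (sec_atan_poly (Suc (Suc n))) E
     = E * poly (sec_atan_poly (Suc n)) E - (of_nat n - 1) * poly (sec_atan_poly n) E"
proof -
  have "(of_nat (n + 2) :: complex) \<noteq> 0"
    by (metis add_is_0 of_nat_eq_0_iff zero_neq_numeral)
  then show ?thesis by (simp add: field_simps del: of_nat_add)
qed

text \<open>Coefficient form of (1 + a t) exp (x arctan t) = sqrt (1 + t^2) exp ((x + a) arctan t)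
  for a^2 = -1. The right-hand side is shown to obey the recursion of \<open>sec_atan_poly\<close>
  at x + a.\<close>

lemma sec_atan_poly_shift:
  assumes a: "a * a = -1"
  shows "poly (sec_atan_poly n) (x + a) = poly (atan_coeff (int n)) x + a * poly (atan_coeff (int n - 1)) x"
proof (induction n rule: sec_atan_poly.induct)
  case (3 n)
  let ?h = "\<lambda>k. poly (atan_coeff (int n + k)) x"
  have h2: "of_nat (n + 2) * ?h 2 = x * ?h 1 - of_nat n * ?h 0"
  proof -
    have "nat (int n + 2) = Suc (Suc n)" "nat (int n + 1) = Suc n" by auto
    then show ?thesis using atan_poly_eval_rec[of n x] by (simp add: atan_coeff_def del: atan_poly.simps)
  qed
  \<comment> \<open>The recursion of \<open>h2\<close> one index lower. For n = 0 the term
    \<open>?h (-1)\<close> is 0 by the convention for negative indices.\<close>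
  have h1: "of_nat (n + 1) * ?h 1 = x * ?h 0 - (of_nat n - 1) * ?h (-1)"
  proof (cases n)
    case 0 then show ?thesis by (simp add: atan_coeff_def)
  next
    case (Suc k)
    have "nat (int n + 1) = Suc (Suc k)" "nat (int n) = Suc k" "nat (int n - 1) = k" "\<not> int n - 1 < 0"
      using Suc by auto
    then show ?thesis using atan_poly_eval_rec[of k x] Suc by (simp add: atan_coeff_def del: atan_poly.simps)
  qed
  have IH1: "poly (sec_atan_poly (Suc n)) (x + a) = ?h 1 + a * ?h 0"
    using 3(1) by (simp add: add.commute)
  have IH0: "poly (sec_atan_poly n) (x + a) = ?h 0 + a * ?h (-1)"
    using 3(2) by simp
  have "of_nat (n + 2) * poly (sec_atan_poly (Suc (Suc n))) (x + a)
     = (x + a) * (?h 1 + a * ?h 0) - (of_nat n - 1) * (?h 0 + a * ?h (-1))"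
    unfolding sec_atan_poly_eval_rec IH1 IH0 ..
  \<comment> \<open>Sorted by powers of a; the surplus is a multiple of a^2 + 1, which is 0.\<close>
  also have "\<dots> = (x * ?h 1 - of_nat n * ?h 0) + a * (x * ?h 0 - (of_nat n - 1) * ?h (-1) + ?h 1)
     + (a * a + 1) * ?h 0"
    by (simp add: algebra_simps)
  also have "\<dots> = of_nat (n + 2) * ?h 2 + a * (of_nat (n + 1) * ?h 1 + ?h 1)"
    unfolding h1[symmetric] h2[symmetric] a by simp
  also have "\<dots> = of_nat (n + 2) * (?h 2 + a * ?h 1)"
    by (simp add: algebra_simps)
  finally have eq: "of_nat (n + 2) * poly (sec_atan_poly (Suc (Suc n))) (x + a)
     = of_nat (n + 2) * (?h 2 + a * ?h 1)" .
  have nz: "(of_nat (n + 2) :: complex) \<noteq> 0"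
    unfolding of_nat_eq_0_iff by simp
  have e: "int (Suc (Suc n)) = int n + 2" "int n + 2 - 1 = int n + 1" by auto
  show ?case unfolding e using eq unfolding mult_left_cancel[OF nz] .
qed (auto simp: atan_coeff_def)

lemma sec_atan_coeff_shift:
  assumes "a * a = -1"
  shows "sec_atan_coeff n \<circ>\<^sub>p [:a, 1:] = atan_coeff n + [:a:] * atan_coeff (n - 1)"
proof (rule poly_ext)
  fix x
  show "poly (sec_atan_coeff n \<circ>\<^sub>p [:a, 1:]) x = poly (atan_coeff n + [:a:] * atan_coeff (n - 1)) x"
    using sec_atan_poly_shift[OF assms, of "nat n" x]
    by (auto simp: poly_pcompose sec_atan_coeff_def atan_coeff_def add.commute)
qed

text \<open>At E = 0 the generating function is sqrt (1 + t^2), which is even in t.\<close>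

lemma sec_atan_coeff_0_odd: "odd n \<Longrightarrow> poly (sec_atan_coeff n) 0 = 0"
proof -
  have "odd k \<Longrightarrow> poly (sec_atan_poly k) 0 = 0" for k
    by (induction k rule: sec_atan_poly.induct) auto
  then show "odd n \<Longrightarrow> poly (sec_atan_coeff n) 0 = 0"
    by (auto simp: sec_atan_coeff_def even_nat_iff)
qed

lemma atan_coeff_0: "poly (atan_coeff n) 0 = of_bool (n = 0)"
proof -
  have "poly (atan_poly k) 0 = of_bool (k = 0)" for k
    by (induction k rule: atan_poly.induct) auto
  then show ?thesis by (auto simp: atan_coeff_def)
qed

text \<open>\<open>umbral_shift\<close> is applied to the determinant P built from
  \<open>sec_atan_coeff\<close>. Shifting E by a = \<open>\<i>\<close> or \<open>-\<i>\<close>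
  expands P over strips with weights \<open>a ^ card S\<close>; the sum of the two expansions
  produces \<open>cos_sign\<close>, and the difference of their values at 0 produces
  \<open>sin_sign\<close>. The odd size makes P vanish at 0.\<close>

lemma umbral_jacobi_trudi_rec:
  assumes odd: "odd (\<Sum>i<p. \<mu> i)"
  shows "(\<Sum>S\<in>Pow {0..<p}. of_real (cos_sign (card S)) * umbral (jacobi_trudi p atan_coeff (remove_strip \<mu> S)))
    = (\<Sum>S\<in>Pow {0..<p}. of_real (sin_sign (card S)) * jacobi_trudi p (\<lambda>n. of_bool (n = 0)) (remove_strip \<mu> S))"
proof -
  define P where "P = jacobi_trudi p sec_atan_coeff \<mu>"
  have shift: "P \<circ>\<^sub>p [:a, 1:] = (\<Sum>S\<in>Pow {0..<p}. smult (a ^ card S) (jacobi_trudi p atan_coeff (remove_strip \<mu> S)))"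
    if "a * a = -1" for a
  proof -
    have "P \<circ>\<^sub>p [:a, 1:] = jacobi_trudi p (\<lambda>n. atan_coeff n + [:a:] * atan_coeff (n - 1)) \<mu>"
      unfolding P_def pcompose_jacobi_trudi sec_atan_coeff_shift[OF that] ..
    then show ?thesis unfolding jacobi_trudi_add_shift by (simp add: poly_const_pow)
  qed
  have ev: "poly P a = (\<Sum>S\<in>Pow {0..<p}. a ^ card S * jacobi_trudi p (\<lambda>n. of_bool (n = 0)) (remove_strip \<mu> S))"
    if "a * a = -1" for a
  proof -
    have "poly P a = poly (P \<circ>\<^sub>p [:a, 1:]) 0" by (simp add: poly_pcompose)
    then show ?thesis unfolding shift[OF that]
      by (simp add: poly_sum poly_jacobi_trudi atan_coeff_0)
  qed
  have P0: "poly P 0 = 0"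
    unfolding P_def poly_jacobi_trudi unfolding jacobi_trudi_leibniz
  proof (rule sum.neutral, rule ballI)
    fix \<sigma> assume s: "\<sigma> \<in> {\<sigma>. \<sigma> permutes {0..<p}}"
    have "(\<Sum>i=0..<p. int (\<sigma> i)) = (\<Sum>i=0..<p. int i)"
      using sum.permute[of \<sigma> "{0..<p}" int] s by (simp add: o_def)
    \<comment> \<open>The indices in each Leibniz product add up to the odd size of
      \<open>\<mu>\<close>, so one of them is odd and its factor vanishes at 0.\<close>
    then have "(\<Sum>i=0..<p. \<mu> i - int i + int (\<sigma> i)) = (\<Sum>i<p. \<mu> i)"
      by (simp add: sum.distrib sum_subtractf atLeast0LessThan)
    then have "\<exists>i\<in>{0..<p}. odd (\<mu> i - int i + int (\<sigma> i))"
    proof (rule contrapos_pp)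
      assume "\<not> (\<exists>i\<in>{0..<p}. odd (\<mu> i - int i + int (\<sigma> i)))"
      then have "even (\<Sum>i=0..<p. \<mu> i - int i + int (\<sigma> i))"
        by (intro dvd_sum) blast
      then show "(\<Sum>i=0..<p. \<mu> i - int i + int (\<sigma> i)) \<noteq> (\<Sum>i<p. \<mu> i)"
        using odd by metis
    qed
    then have "(\<Prod>i=0..<p. poly (sec_atan_coeff (\<mu> i - int i + int (\<sigma> i))) 0) = 0"
      by (intro prod_zero) (blast intro: sec_atan_coeff_0_odd)+
    then show "signof \<sigma> * (\<Prod>i=0..<p. poly (sec_atan_coeff (\<mu> i - int i + int (\<sigma> i))) 0) = 0" by simp
  qed
  have u: "umbral (P \<circ>\<^sub>p [:a, 1:]) = (\<Sum>S\<in>Pow {0..<p}. a ^ card S * umbral (jacobi_trudi p atan_coeff (remove_strip \<mu> S)))"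
    if "a * a = -1" for a
    unfolding shift[OF that] umbral_def by (simp add: moment_functional_sum moment_functional_smult)
  have "2 * (\<Sum>S\<in>Pow {0..<p}. of_real (cos_sign (card S)) * umbral (jacobi_trudi p atan_coeff (remove_strip \<mu> S)))
     = umbral (P \<circ>\<^sub>p [:\<i>, 1:]) + umbral (P \<circ>\<^sub>p [:-\<i>, 1:])"
    by (simp add: u i_power neg_i_power sum.distrib[symmetric] sum_distrib_left algebra_simps)
  also have "\<dots> = (poly P \<i> - poly P (-\<i>)) / \<i>"
    unfolding umbral_shift P0 by simp
  also have "\<dots> = 2 * (\<Sum>S\<in>Pow {0..<p}. of_real (sin_sign (card S)) * jacobi_trudi p (\<lambda>n. of_bool (n = 0)) (remove_strip \<mu> S))"
    by (simp add: ev i_power neg_i_power sum_subtractf[symmetric] sum_distrib_left sum_divide_distrib algebra_simps)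
  finally show ?thesis by simp
qed

subsection \<open>Ballot words\<close>

text \<open>A standard tableau is encoded by the list of the rows of its entries, starting with the largest
  entry, so that the suffixes are the sub-tableaux.\<close>

fun ballot :: "nat list \<Rightarrow> bool" where
  "ballot [] \<longleftrightarrow> True"
| "ballot (x # w) \<longleftrightarrow> ballot w \<and> (\<forall>i. count_list (x # w) (Suc i) \<le> count_list (x # w) i)"

text \<open>The encoding of reverse alternating tableaux of odd size.\<close>

fun zigzag :: "nat list \<Rightarrow> bool" where
  "zigzag [] \<longleftrightarrow> False"
| "zigzag [x] \<longleftrightarrow> True"
| "zigzag [x, y] \<longleftrightarrow> False"
| "zigzag (x # y # z # w) \<longleftrightarrow> y < x \<and> y \<le> z \<and> zigzag (z # w)"

abbreviation decreasing :: "nat list \<Rightarrow> bool" where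
  "decreasing \<equiv> sorted_wrt (>)"

text \<open>Counts are compared as integers, so the set is empty when \<open>\<mu>\<close> has a
  negative entry.\<close>

definition words :: "(nat \<Rightarrow> int) \<Rightarrow> nat list set" where
  "words \<mu> = {w. ballot w \<and> (\<forall>i. int (count_list w i) = \<mu> i)}"

lemma ballot_count: "ballot w \<Longrightarrow> count_list w (Suc i) \<le> count_list w i"
  by (cases w) auto

lemma ballot_appendD: "ballot (u @ v) \<Longrightarrow> ballot v"
  by (induction u) auto

text \<open>Dropping the first letter x of a decreasing prefix could break the condition only at i =
  x. Neither x nor \<open>Suc x\<close> occurs in the rest of the prefix, so the counts there are
  those of v.\<close>

lemma ballot_append_decreasing:
  assumes "ballot v" "decreasing u" "\<And>i. count_list (u @ v) (Suc i) \<le> count_list (u @ v) i"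
  shows "ballot (u @ v)"
  using assms(2,3)
proof (induction u)
  case (Cons x u)
  have "count_list (u @ v) (Suc i) \<le> count_list (u @ v) i" for i
  proof (cases "i = x")
    case True
    have "x \<notin> set u" "Suc x \<notin> set u" using Cons.prems(1) by auto
    then show ?thesis using ballot_count[OF assms(1), of x] True by (simp add: count_list_0_iff)
  next
    case False
    then show ?thesis using Cons.prems(2)[of i] by (auto split: if_splits)
  qed
  then have "ballot (u @ v)" using Cons by simp
  then show ?case using Cons.prems(2) by simp
qed (use assms in simp)

lemma cos_sign_add2: "cos_sign (Suc (Suc k)) = - cos_sign k"
  by (simp add: cos_sign_def)

lemma sin_sign_add2: "sin_sign (Suc (Suc k)) = - sin_sign k"
  by (simp add: sin_sign_def)

text \<open>If \<open>w\<close> is not decreasing, then at most two splittings contribute, and they cancel.\<close>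

lemma signed_decreasing_zigzag:
  assumes "odd (length w)"
  shows "(\<Sum>k\<le>length w. cos_sign k * of_bool (decreasing (take k w) \<and> zigzag (drop k w)))
       = sin_sign (length w) * of_bool (decreasing w)"
  using assms
proof (induction w rule: zigzag.induct)
  case (4 x y z w)
  let ?v = "z # w"
  let ?g = "\<lambda>w k. cos_sign k * of_bool (decreasing (take k w) \<and> zigzag (drop k w))"
  have IH: "(\<Sum>k\<le>length ?v. ?g ?v k) = sin_sign (length ?v) * of_bool (decreasing ?v)"
    using 4 by simp
  have split: "(\<Sum>k\<le>length (x # y # ?v). ?g (x # y # ?v) k) =
      ?g (x # y # ?v) 0 + ?g (x # y # ?v) 1 + (\<Sum>k\<le>length ?v. ?g (x # y # ?v) (Suc (Suc k)))"
  proof -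
    have "length (x # y # ?v) = Suc (Suc (length ?v))" by simp
    then show ?thesis by (simp only: sum.atMost_Suc_shift) (simp add: add.assoc)
  qed
  have g1: "?g (x # y # ?v) 1 = 0" by (simp add: cos_sign_def)
  have dec: "decreasing (x # y # t) \<longleftrightarrow> y < x \<and> (\<forall>a\<in>set t. a < y) \<and> decreasing t" for t
    by auto
  have decz: "decreasing (x # y # z # t) \<longleftrightarrow> y < x \<and> z < y \<and> decreasing (z # t)" for t
    by auto
  \<comment> \<open>Without a descent at the front only prefixes of length at most 1 are decreasing,
    and nothing contributes. For x > y > z the word is not zigzag, and two more prefix letters flip
    the sign of the sum for \<open>z # w\<close>. For y < x and y \<le> z only k = 0 and k = 2 can
    contribute, with opposite signs.\<close>
  consider "\<not> y < x" | "y < x" "z < y" | "y < x" "y \<le> z" by linarith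
  then show ?case
  proof cases
    case 1
    then show ?thesis unfolding split g1 by simp
  next
    case 2
    have "(\<Sum>k\<le>length ?v. ?g (x # y # ?v) (Suc (Suc k))) = (\<Sum>k\<le>length ?v. - ?g ?v k)"
    proof (intro sum.cong refl)
      fix k
      have "decreasing (take (Suc (Suc k)) (x # y # ?v)) \<longleftrightarrow> decreasing (take k ?v)"
        using 2 by (cases k) auto
      then show "?g (x # y # ?v) (Suc (Suc k)) = - ?g ?v k"
        by (simp add: cos_sign_add2)
    qed
    also have "\<dots> = - (sin_sign (length ?v) * of_bool (decreasing ?v))"
      unfolding sum_negf IH ..
    finally show ?thesis unfolding split g1 using 2 decz[of w]
      by (simp add: sin_sign_add2)
  next
    case 3
    have "(\<Sum>k\<le>length ?v. ?g (x # y # ?v) (Suc (Suc k))) = (\<Sum>k\<in>{0}. ?g (x # y # ?v) (Suc (Suc k)))"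
    proof (rule sum.mono_neutral_right)
      show "\<forall>k\<in>{..length ?v} - {0}. ?g (x # y # ?v) (Suc (Suc k)) = 0"
      proof
        fix k assume "k \<in> {..length ?v} - {0}"
        then obtain l where "k = Suc l" by (cases k) auto
        then show "?g (x # y # ?v) (Suc (Suc k)) = 0" using 3 by auto
      qed
    qed auto
    also have "\<dots> = - of_bool (zigzag ?v)"
      using 3 by (simp add: cos_sign_def)
    finally have tail: "(\<Sum>k\<le>length ?v. ?g (x # y # ?v) (Suc (Suc k))) = - of_bool (zigzag ?v)" .
    have head: "?g (x # y # ?v) 0 = of_bool (zigzag ?v)"
      using 3 by (simp add: cos_sign_def)
    have "\<not> decreasing (x # y # ?v)" using 3 decz[of w] by simp
    then show ?thesis unfolding split g1 head tail by simp
  qed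
qed (auto simp: cos_sign_def sin_sign_def)

text \<open>The determinant sees the first p rows only, while letter counts range over all naturals;
  hence \<open>\<mu>\<close> is fixed to 0 from row p on.\<close>

locale shape =
  fixes p :: nat and \<mu> :: "nat \<Rightarrow> int"
  assumes support: "\<And>i. p \<le> i \<Longrightarrow> \<mu> i = 0"
begin

lemma words_set: "w \<in> words \<mu> \<Longrightarrow> set w \<subseteq> {0..<p}"
proof
  fix i assume w: "w \<in> words \<mu>" and i: "i \<in> set w"
  then have "count_list w i \<noteq> 0" by (simp add: count_list_0_iff)
  then have "\<mu> i \<noteq> 0" using w unfolding words_def by (metis (mono_tags, lifting) mem_Collect_eq of_nat_eq_0_iff)
  then show "i \<in> {0..<p}" using support[of i] by (auto simp: not_le[symmetric])
qed

lemma words_length: "w \<in> words \<mu> \<Longrightarrow> int (length w) = (\<Sum>i<p. \<mu> i)"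
proof -
  assume w: "w \<in> words \<mu>"
  have "length w = sum (count_list w) {0..<p}"
    using sum_count_set[of w "{0..<p}"] words_set[OF w] by simp
  then show ?thesis using w by (simp add: words_def atLeast0LessThan)
qed

lemma finite_words: "finite (words \<mu>)"
proof (rule finite_subset)
  show "words \<mu> \<subseteq> {w. set w \<subseteq> {0..<p} \<and> length w = nat (\<Sum>i<p. \<mu> i)}"
    using words_set words_length by force
  show "finite {w. set w \<subseteq> {0..<p} \<and> length w = nat (\<Sum>i<p. \<mu> i)}"
    by (rule finite_lists_length_eq) simp
qed

lemma words_dominant: "words \<mu> \<noteq> {} \<Longrightarrow> dominant p \<mu>"
proof -
  assume "words \<mu> \<noteq> {}"
  then obtain w where w: "ballot w" "\<And>i. int (count_list w i) = \<mu> i" by (auto simp: words_def)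
  show ?thesis unfolding dominant_def w(2)[symmetric] using ballot_count[OF w(1)] by simp
qed

lemma shape_remove_strip: "S \<subseteq> {0..<p} \<Longrightarrow> shape p (remove_strip \<mu> S)"
  by unfold_locales (auto simp: remove_strip_def support)

end

text \<open>A decreasing word is determined by its set of letters; this matches decreasing prefixes
  with strips.\<close>

lemma rev_sorted_list_of_decreasing:
  assumes "decreasing u"
  shows "rev (sorted_list_of_set (set u)) = u" "distinct u"
proof -
  have "sorted_wrt (<) (rev u)" using assms by (simp add: sorted_wrt_rev)
  then have s: "sorted (rev u)" "distinct (rev u)" by (auto simp: strict_sorted_iff)
  then have "sorted_list_of_set (set (rev u)) = rev u"
    using sorted_list_of_set.idem_if_sorted_distinct by blast
  then show "rev (sorted_list_of_set (set u)) = u" by simp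
  show "distinct u" using s by simp
qed

lemma decreasing_rev_sorted_list_of_set: "decreasing (rev (sorted_list_of_set S))"
  using strict_sorted_list_of_set[of S] by (simp add: sorted_wrt_rev)

lemma count_list_distinct: "distinct u \<Longrightarrow> count_list u i = of_bool (i \<in> set u)"
  by (induction u) auto

lemma strip_append_in_words:
  assumes "dominant p \<mu>" "shape p \<mu>" "S \<subseteq> {0..<p}" "v \<in> words (remove_strip \<mu> S)"
  shows "rev (sorted_list_of_set S) @ v \<in> words \<mu>"
proof -
  have fin: "finite S" using assms(3) by (rule finite_subset) simp
  have c: "int (count_list (rev (sorted_list_of_set S) @ v) i) = \<mu> i" for i
    using assms(4) fin by (auto simp: words_def remove_strip_def count_list_distinct)
  have mono: "\<mu> (Suc i) \<le> \<mu> i" for i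
  proof (cases "Suc i < p")
    case True then show ?thesis using assms(1) by (simp add: dominant_def)
  next
    case False
    then have "\<mu> (Suc i) = 0" using assms(2) by (simp add: shape_def)
    moreover have "\<mu> i \<ge> 0" using assms(1,2) by (cases "i < p") (auto simp: dominant_def shape_def)
    ultimately show ?thesis by simp
  qed
  have "ballot (rev (sorted_list_of_set S) @ v)"
  proof (rule ballot_append_decreasing)
    show "ballot v" using assms(4) by (simp add: words_def)
    fix i show "count_list (rev (sorted_list_of_set S) @ v) (Suc i) \<le> count_list (rev (sorted_list_of_set S) @ v) i"
      using mono[of i] unfolding c[symmetric] by simp
  qed (rule decreasing_rev_sorted_list_of_set)
  then show ?thesis using c by (simp add: words_def)
qed

context shape begin

lemma drop_in_words:
  assumes "w \<in> words \<mu>" "decreasing (take k w)"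
  shows "drop k w \<in> words (remove_strip \<mu> (set (take k w)))"
proof -
  have "ballot (take k w @ drop k w)" using assms by (simp add: words_def)
  then have "ballot (drop k w)" by (rule ballot_appendD)
  moreover have "int (count_list (drop k w) i) = remove_strip \<mu> (set (take k w)) i" for i
  proof -
    have "count_list w i = count_list (take k w) i + count_list (drop k w) i"
      by (metis append_take_drop_id count_list_append)
    then show ?thesis
      using assms rev_sorted_list_of_decreasing(2)[OF assms(2)]
      by (auto simp: words_def remove_strip_def count_list_distinct dest: spec[of _ i])
  qed
  ultimately show ?thesis by (simp add: words_def)
qed

text \<open>A strip S, written in decreasing order, is glued in front of a zigzag word of the
  remaining content; conversely a word of content \<open>\<mu>\<close> is cut after a decreasing
  prefix. Summing over the cuts first, \<open>signed_decreasing_zigzag\<close> leaves only the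
  decreasing words.\<close>

lemma zigzag_words_rec:
  assumes dom: "dominant p \<mu>" and odd: "odd (\<Sum>i<p. \<mu> i)"
  shows "(\<Sum>S\<in>Pow {0..<p}. cos_sign (card S) * real (card {w \<in> words (remove_strip \<mu> S). zigzag w}))
    = (\<Sum>S\<in>Pow {0..<p}. sin_sign (card S) * of_bool (\<forall>i<p. remove_strip \<mu> S i = 0))"
proof -
  define n where "n = nat (\<Sum>i<p. \<mu> i)"
  have len: "length w = n" if "w \<in> words \<mu>" for w
    using words_length[OF that] by (simp add: n_def)
  have sh: "shape p \<mu>" by unfold_locales
  have finS: "finite S" if "S \<subseteq> {0..<p}" for S using that by (rule finite_subset) simp
  have finW: "finite (words (remove_strip \<mu> S))" if "S \<subseteq> {0..<p}" for S
    using shape.finite_words[OF shape_remove_strip[OF that]] .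
  define Z where "Z = (SIGMA w:words \<mu>. {k \<in> {..n}. decreasing (take k w) \<and> zigzag (drop k w)})"
  have "(\<Sum>S\<in>Pow {0..<p}. cos_sign (card S) * real (card {w \<in> words (remove_strip \<mu> S). zigzag w}))
    = (\<Sum>S\<in>Pow {0..<p}. \<Sum>v\<in>{w \<in> words (remove_strip \<mu> S). zigzag w}. cos_sign (card S))"
    by (simp add: mult.commute)
  also have "\<dots> = (\<Sum>(S, v)\<in>(SIGMA S:Pow {0..<p}. {w \<in> words (remove_strip \<mu> S). zigzag w}). cos_sign (card S))"
    by (rule sum.Sigma) (auto simp: finW)
  also have "\<dots> = (\<Sum>(w, k)\<in>Z. cos_sign k)"
  proof (rule sum.reindex_bij_witness[of _ "\<lambda>(w, k). (set (take k w), drop k w)"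
        "\<lambda>(S, v). (rev (sorted_list_of_set S) @ v, card S)"])
    fix a assume a: "a \<in> (SIGMA S:Pow {0..<p}. {w \<in> words (remove_strip \<mu> S). zigzag w})"
    obtain S v where Sv: "a = (S, v)" by (cases a)
    have S: "S \<subseteq> {0..<p}" and v: "v \<in> words (remove_strip \<mu> S)" "zigzag v" using a Sv by auto
    have l: "length (rev (sorted_list_of_set S)) = card S" by simp
    show "(case case a of (S, v) \<Rightarrow> (rev (sorted_list_of_set S) @ v, card S) of
          (w, k) \<Rightarrow> (set (take k w), drop k w)) = a"
      using finS[OF S] by (simp add: Sv)
    have in_w: "rev (sorted_list_of_set S) @ v \<in> words \<mu>"
      by (rule strip_append_in_words[OF dom sh S v(1)])
    then show "(case a of (S, v) \<Rightarrow> (rev (sorted_list_of_set S) @ v, card S)) \<in> Z"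
      using v len[OF in_w] decreasing_rev_sorted_list_of_set[of S]
      by (auto simp: Sv Z_def)
    show "(case case a of (S, v) \<Rightarrow> (rev (sorted_list_of_set S) @ v, card S) of (w, k) \<Rightarrow> cos_sign k)
        = (case a of (S, v) \<Rightarrow> cos_sign (card S))"
      by (simp add: Sv)
  next
    fix b assume b: "b \<in> Z"
    obtain w k where wk: "b = (w, k)" by (cases b)
    have w: "w \<in> words \<mu>" "k \<le> n" "decreasing (take k w)" "zigzag (drop k w)" using b by (auto simp: wk Z_def)
    have card: "card (set (take k w)) = k"
      using w len[OF w(1)] distinct_card[OF rev_sorted_list_of_decreasing(2)[OF w(3)]] by simp
    show "(case case b of (w, k) \<Rightarrow> (set (take k w), drop k w) of
            (S, v) \<Rightarrow> (rev (sorted_list_of_set S) @ v, card S)) = b"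
      using rev_sorted_list_of_decreasing(1)[OF w(3)] card by (simp add: wk)
    show "(case b of (w, k) \<Rightarrow> (set (take k w), drop k w))
        \<in> (SIGMA S:Pow {0..<p}. {w \<in> words (remove_strip \<mu> S). zigzag w})"
      using drop_in_words[OF w(1,3)] w(4) words_set[OF w(1)] set_take_subset[of k w]
      by (auto simp: wk)
  qed
  also have "\<dots> = (\<Sum>w\<in>words \<mu>. \<Sum>k | k \<in> {..n} \<and> decreasing (take k w) \<and> zigzag (drop k w). cos_sign k)"
    unfolding Z_def by (rule sum.Sigma[symmetric]) (auto simp: finite_words)
  also have "\<dots> = (\<Sum>w\<in>words \<mu>. \<Sum>k\<le>n. cos_sign k * of_bool (decreasing (take k w) \<and> zigzag (drop k w)))"
    by (intro sum.cong refl sum.mono_neutral_cong_left) auto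
  also have "\<dots> = (\<Sum>w\<in>words \<mu>. sin_sign n * of_bool (decreasing w))"
  proof (rule sum.cong[OF refl])
    fix w assume w: "w \<in> words \<mu>"
    have "odd (length w)" using words_length[OF w] odd by (metis even_of_nat)
    from signed_decreasing_zigzag[OF this] len[OF w]
    show "(\<Sum>k\<le>n. cos_sign k * of_bool (decreasing (take k w) \<and> zigzag (drop k w)))
        = sin_sign n * of_bool (decreasing w)" by simp
  qed
  also have "\<dots> = (\<Sum>w | w \<in> words \<mu> \<and> decreasing w. sin_sign n)"
    by (intro sum.mono_neutral_cong_right) (auto simp: finite_words)
  \<comment> \<open>A decreasing word of content \<open>\<mu>\<close> is a strip that exhausts
    \<open>\<mu>\<close>.\<close>
  also have "\<dots> = (\<Sum>S | S \<in> Pow {0..<p} \<and> (\<forall>i<p. remove_strip \<mu> S i = 0). sin_sign (card S))"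
  proof (rule sum.reindex_bij_witness[of _ "\<lambda>S. rev (sorted_list_of_set S)" set])
    fix w assume "w \<in> {w. w \<in> words \<mu> \<and> decreasing w}"
    then have w: "w \<in> words \<mu>" "decreasing w" by auto
    note rev_sorted_list_of_decreasing[OF w(2)]
    then show "rev (sorted_list_of_set (set w)) = w" "sin_sign (card (set w)) = sin_sign n"
      using len[OF w(1)] by (auto simp: distinct_card)
    have "[] \<in> words (remove_strip \<mu> (set w))"
      using drop_in_words[OF w(1), of "length w"] w by simp
    then have "\<forall>i. remove_strip \<mu> (set w) i = 0" by (simp add: words_def)
    then show "set w \<in> {S. S \<in> Pow {0..<p} \<and> (\<forall>i<p. remove_strip \<mu> S i = 0)}"
      using words_set[OF w(1)] by auto
  next
    fix S assume "S \<in> {S. S \<in> Pow {0..<p} \<and> (\<forall>i<p. remove_strip \<mu> S i = 0)}"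
    then have S: "S \<subseteq> {0..<p}" "\<forall>i<p. remove_strip \<mu> S i = 0" by auto
    have "remove_strip \<mu> S i = 0" for i
      using S shape.support[OF shape_remove_strip[OF S(1)], of i] by (cases "i < p") auto
    then have "[] \<in> words (remove_strip \<mu> S)" by (simp add: words_def)
    from strip_append_in_words[OF dom sh S(1) this]
    show "rev (sorted_list_of_set S) \<in> {w. w \<in> words \<mu> \<and> decreasing w}"
      using decreasing_rev_sorted_list_of_set by simp
    show "set (rev (sorted_list_of_set S)) = S" using finS[OF S(1)] by simp
  qed
  also have "\<dots> = (\<Sum>S\<in>Pow {0..<p}. sin_sign (card S) * of_bool (\<forall>i<p. remove_strip \<mu> S i = 0))"
    by (intro sum.mono_neutral_cong_left) auto
  finally show ?thesis .
qed

end

text \<open>Induction on the size: both sides obey the same recursion over strips, in which S = {}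
  has weight 1 and gives \<open>\<mu>\<close> itself. \<open>cos_sign\<close> vanishes on strips of
  odd size, so the smaller sizes stay odd, and strips that destroy dominance contribute 0 on both
  sides.\<close>

lemma card_zigzag_words:
  assumes "shape p \<mu>" "dominant p \<mu>" "odd (\<Sum>i<p. \<mu> i)"
  shows "of_nat (card {w \<in> words \<mu>. zigzag w}) = umbral (jacobi_trudi p atan_coeff \<mu>)"
  using assms
proof (induction "nat (\<Sum>i<p. \<mu> i)" arbitrary: \<mu> rule: less_induct)
  case less
  interpret shape p \<mu> by fact
  let ?N = "\<lambda>S. complex_of_real (real (card {w \<in> words (remove_strip \<mu> S). zigzag w}))"
  let ?U = "\<lambda>S. umbral (jacobi_trudi p atan_coeff (remove_strip \<mu> S))"
  have fin: "finite (Pow {0..<p})" by simp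
  have sum_strip: "(\<Sum>i<p. remove_strip \<mu> S i) = (\<Sum>i<p. \<mu> i) - int (card S)" if "S \<subseteq> {0..<p}" for S
  proof -
    have "(\<Sum>i<p. (of_bool (i \<in> S) :: int)) = int (card ({..<p} \<inter> S))"
      by (simp add: of_bool_def sum.If_cases Int_def)
    also have "{..<p} \<inter> S = S" using that by auto
    finally show ?thesis by (simp add: remove_strip_def sum_subtractf)
  qed
  have step: "of_real (cos_sign (card S)) * ?N S = of_real (cos_sign (card S)) * ?U S"
    if S: "S \<in> Pow {0..<p} - {{}}" for S
  proof (cases "even (card S)")
    case False then show ?thesis by (simp add: cos_sign_def)
  next
    case True
    have Sp: "S \<subseteq> {0..<p}" using S by auto
    then have "card S > 0" using S by (auto simp: card_gt_0_iff intro: finite_subset)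
    show ?thesis
    proof (cases "dominant p (remove_strip \<mu> S)")
      case dom: True
      have "(\<Sum>i<p. remove_strip \<mu> S i) \<ge> 0" using dom by (intro sum_nonneg) (auto simp: dominant_def)
      then have lt: "nat (\<Sum>i<p. remove_strip \<mu> S i) < nat (\<Sum>i<p. \<mu> i)"
        using sum_strip[OF Sp] \<open>card S > 0\<close> by auto
      have "odd (\<Sum>i<p. remove_strip \<mu> S i)"
        using less.prems(3) True unfolding sum_strip[OF Sp] by simp
      from less.hyps[OF lt shape_remove_strip[OF Sp] dom this] show ?thesis by simp
    next
      case False
      then have "words (remove_strip \<mu> S) = {}"
        using shape.words_dominant[OF shape_remove_strip[OF Sp]] by blast
      moreover have "jacobi_trudi p atan_coeff (remove_strip \<mu> S) = 0"
        by (rule jacobi_trudi_not_dominant[OF _ less.prems(2) False]) (simp add: atan_coeff_def)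
      ultimately show ?thesis by (simp add: umbral_def)
    qed
  qed
  have "(\<Sum>S\<in>Pow {0..<p}. of_real (cos_sign (card S)) * ?N S)
     = complex_of_real (\<Sum>S\<in>Pow {0..<p}. cos_sign (card S) * real (card {w \<in> words (remove_strip \<mu> S). zigzag w}))"
    by simp
  also have "\<dots> = (\<Sum>S\<in>Pow {0..<p}. of_real (sin_sign (card S)) * of_bool (\<forall>i<p. remove_strip \<mu> S i = 0))"
    unfolding zigzag_words_rec[OF less.prems(2,3)] by simp
  also have "\<dots> = (\<Sum>S\<in>Pow {0..<p}. of_real (sin_sign (card S)) * jacobi_trudi p (\<lambda>n. of_bool (n = 0)) (remove_strip \<mu> S))"
  proof (intro sum.cong refl arg_cong2[where f = "(*)"])
    fix S
    show "of_bool (\<forall>i<p. remove_strip \<mu> S i = 0) = (jacobi_trudi p (\<lambda>n. of_bool (n = 0)) (remove_strip \<mu> S) :: complex)"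
    proof (cases "dominant p (remove_strip \<mu> S)")
      case True then show ?thesis by (simp add: jacobi_trudi_delta)
    next
      case False
      then have "\<not> (\<forall>i<p. remove_strip \<mu> S i = 0)"
        unfolding dominant_def by (metis Suc_lessD order_refl)
      moreover have "jacobi_trudi p (\<lambda>n. of_bool (n = 0)) (remove_strip \<mu> S) = (0 :: complex)"
        by (rule jacobi_trudi_not_dominant[OF _ less.prems(2) False]) simp
      ultimately show ?thesis by simp
    qed
  qed
  also have "\<dots> = (\<Sum>S\<in>Pow {0..<p}. of_real (cos_sign (card S)) * ?U S)"
    using umbral_jacobi_trudi_rec[OF less.prems(3)] by simp
  finally have total: "(\<Sum>S\<in>Pow {0..<p}. of_real (cos_sign (card S)) * ?N S)
    = (\<Sum>S\<in>Pow {0..<p}. of_real (cos_sign (card S)) * ?U S)" .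
  have rest: "(\<Sum>S\<in>Pow {0..<p} - {{}}. of_real (cos_sign (card S)) * ?N S)
    = (\<Sum>S\<in>Pow {0..<p} - {{}}. of_real (cos_sign (card S)) * ?U S)"
    by (rule sum.cong[OF refl step])
  have "of_real (cos_sign (card ({} :: nat set))) * ?N {} = of_real (cos_sign (card ({} :: nat set))) * ?U {}"
    using total unfolding sum.remove[OF fin Pow_bottom] rest by (rule add_right_imp_eq)
  moreover have "remove_strip \<mu> {} = \<mu>" by (simp add: remove_strip_def fun_eq_iff)
  ultimately show ?case by (simp add: cos_sign_def)
qed

subsection \<open>Square tableaux\<close>

lemma diagram_square: "diagram (square_shape p) = {..<p} \<times> {..<p}"
  by (auto simp: diagram_def square_shape_def)

lemma sum_list_square: "sum_list (square_shape p) = p * p"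
  by (simp add: square_shape_def sum_list_replicate)

section \<open>Words written as functions of the entries 1, ..., n\<close>

primrec reverse_word :: "(nat \<Rightarrow> nat) \<Rightarrow> nat \<Rightarrow> nat list" where
  "reverse_word r 0 = []"
| "reverse_word r (Suc n) = r (Suc n) # reverse_word r n"

lemma length_reverse_word [simp]: "length (reverse_word r n) = n"
  by (induction n) auto

lemma nth_reverse_word: "k \<in> {1..n} \<Longrightarrow> reverse_word r n ! (n - k) = r k"
  by (induction n) (auto simp: nth_Cons' Suc_diff_le le_Suc_eq)

lemma reverse_word_cong: "(\<And>k. k \<in> {1..n} \<Longrightarrow> r k = r' k) \<Longrightarrow> reverse_word r n = reverse_word r' n"
  by (induction n) auto

lemma reverse_word_nth: "reverse_word (\<lambda>k. w ! (length w - k)) (length w) = w"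
proof (induction w)
  case (Cons x w)
  have "reverse_word (\<lambda>k. (x # w) ! (Suc (length w) - k)) (length w) = reverse_word (\<lambda>k. w ! (length w - k)) (length w)"
    by (rule reverse_word_cong) (auto simp: Suc_diff_le)
  then show ?case using Cons by simp
qed simp

lemma count_reverse_word: "count_list (reverse_word r n) i = card {k \<in> {1..n}. r k = i}"
proof (induction n)
  case (Suc n)
  have "{k \<in> {1..Suc n}. r k = i} = {k \<in> {1..n}. r k = i} \<union> (if r (Suc n) = i then {Suc n} else {})"
    by (auto simp: le_Suc_eq)
  then show ?case using Suc by auto
qed simp

lemma ballot_reverse_word:
  "ballot (reverse_word r n) \<longleftrightarrow>
     (\<forall>m\<le>n. \<forall>i. card {k \<in> {1..m}. r k = Suc i} \<le> card {k \<in> {1..m}. r k = i})"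
proof (induction n)
  case (Suc n)
  have "ballot (reverse_word r (Suc n)) \<longleftrightarrow> ballot (reverse_word r n) \<and>
    (\<forall>i. count_list (reverse_word r (Suc n)) (Suc i) \<le> count_list (reverse_word r (Suc n)) i)"
    by (simp only: reverse_word.simps ballot.simps)
  then show ?case unfolding Suc count_reverse_word by (auto simp: le_Suc_eq)
qed simp

text \<open>The word reads r n, r (n - 1), ..., so unfolding \<open>zigzag\<close> once treats two
  indices: the even k = n - 1 must be an ascent, the odd k = n - 2 must not.\<close>

lemma zigzag_reverse_word:
  assumes "odd n"
  shows "zigzag (reverse_word r n) \<longleftrightarrow> (\<forall>k\<in>{1..<n}. r k < r (Suc k) \<longleftrightarrow> even k)"
proof -
  have "zigzag (reverse_word r (Suc (2 * m))) \<longleftrightarrow> (\<forall>k\<in>{1..<Suc (2 * m)}. r k < r (Suc k) \<longleftrightarrow> even k)" for m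
  proof (induction m)
    case (Suc m)
    have "{1..<Suc (2 * Suc m)} = insert (Suc (Suc (2 * m))) (insert (Suc (2 * m)) {1..<Suc (2 * m)})"
      by auto
    then show ?case using Suc by (auto simp: not_less)
  qed simp
  then show ?thesis using assms by (metis oddE Suc_eq_plus1)
qed

text \<open>Translates positions in a sorted row into counts, so that comparing entries in a column
  becomes a ballot inequality.\<close>

lemma sorted_list_of_set_nth_le_iff:
  fixes R :: "nat set"
  assumes "finite R" "j < card R"
  shows "sorted_list_of_set R ! j \<le> m \<longleftrightarrow> j < card {k \<in> R. k \<le> m}"
proof -
  let ?L = "sorted_list_of_set R"
  have len: "length ?L = card R" and set: "set ?L = R" using assms by auto
  have mono: "a \<le> b \<Longrightarrow> b < card R \<Longrightarrow> ?L ! a \<le> ?L ! b" for a b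
    using len by (intro sorted_nth_mono) auto
  have inj: "inj_on ((!) ?L) A" if "A \<subseteq> {..<card R}" for A
    by (rule inj_on_nth) (use len that in auto)
  show ?thesis
  proof
    assume le: "?L ! j \<le> m"
    have "(!) ?L ` {..j} \<subseteq> {k \<in> R. k \<le> m}"
    proof
      fix k assume "k \<in> (!) ?L ` {..j}"
      then obtain a where a: "a \<le> j" "k = ?L ! a" by auto
      then have "k \<in> R" using len set assms(2) nth_mem[of a ?L] by simp
      then show "k \<in> {k \<in> R. k \<le> m}" using mono[of a j] a le assms(2) by auto
    qed
    then have "card ((!) ?L ` {..j}) \<le> card {k \<in> R. k \<le> m}"
      using assms(1) by (intro card_mono) auto
    then show "j < card {k \<in> R. k \<le> m}"
      using card_image[OF inj[of "{..j}"]] assms(2) by (simp add: subset_iff)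
  next
    assume j: "j < card {k \<in> R. k \<le> m}"
    show "?L ! j \<le> m"
    proof (rule ccontr)
      assume "\<not> ?L ! j \<le> m"
      have "{k \<in> R. k \<le> m} \<subseteq> (!) ?L ` {..<j}"
      proof
        fix k assume k: "k \<in> {k \<in> R. k \<le> m}"
        then obtain a where a: "a < card R" "k = ?L ! a" using set len by (metis in_set_conv_nth mem_Collect_eq)
        then have "a < j" using mono[of j a] k \<open>\<not> ?L ! j \<le> m\<close> by (auto simp: not_le[symmetric])
        then show "k \<in> (!) ?L ` {..<j}" using a by auto
      qed
      then have "card {k \<in> R. k \<le> m} \<le> card ((!) ?L ` {..<j})" by (intro card_mono) auto
      also have "\<dots> \<le> j" using card_image_le[of "{..<j}" "(!) ?L"] by simp
      finally show False using j by simp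
    qed
  qed
qed

section \<open>The bijection between square tableaux and ballot words\<close>

definition entry_row :: "nat \<Rightarrow> (nat \<times> nat \<Rightarrow> nat) \<Rightarrow> nat \<Rightarrow> nat" where
  "entry_row p T k = fst (inv_into ({..<p} \<times> {..<p}) T k)"

definition reading_word :: "nat \<Rightarrow> (nat \<times> nat \<Rightarrow> nat) \<Rightarrow> nat list" where
  "reading_word p T = reverse_word (entry_row p T) (p * p)"

definition word_rows :: "nat \<Rightarrow> nat list \<Rightarrow> nat \<Rightarrow> nat set" where
  "word_rows p w i = {k \<in> {1..p * p}. w ! (p * p - k) = i}"

definition word_tableau :: "nat \<Rightarrow> nat list \<Rightarrow> nat \<times> nat \<Rightarrow> nat" where
  "word_tableau p w = restrict (\<lambda>(i, j). sorted_list_of_set (word_rows p w i) ! j) ({..<p} \<times> {..<p})"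

definition square_content :: "nat \<Rightarrow> nat \<Rightarrow> int" where
  "square_content p i = (if i < p then int p else 0)"

lemma syt_square_iff:
  "T \<in> syt (square_shape p) \<longleftrightarrow> T \<in> extensional ({..<p} \<times> {..<p}) \<and>
     bij_betw T ({..<p} \<times> {..<p}) {1..p * p} \<and>
     (\<forall>i j j'. i < p \<and> j < j' \<and> j' < p \<longrightarrow> T (i, j) < T (i, j')) \<and>
     (\<forall>i i' j. i < i' \<and> i' < p \<and> j < p \<longrightarrow> T (i, j) < T (i', j))"
  unfolding syt_def diagram_square sum_list_square by auto

lemma syt_square_range:
  "T \<in> syt (square_shape p) \<Longrightarrow> i < p \<Longrightarrow> j < p \<Longrightarrow> T (i, j) \<in> {1..p * p}"
  unfolding syt_square_iff bij_betw_def by blast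

lemma entry_row_eq:
  assumes "bij_betw T ({..<p} \<times> {..<p}) {1..p * p}" "i < p" "j < p"
  shows "entry_row p T (T (i, j)) = i"
  using assms by (simp add: entry_row_def bij_betw_def inv_into_f_f)

lemma entry_obtain:
  assumes "bij_betw T ({..<p} \<times> {..<p}) {1..p * p}" "k \<in> {1..p * p}"
  obtains i j where "i < p" "j < p" "T (i, j) = k"
proof -
  have "k \<in> T ` ({..<p} \<times> {..<p})" using assms by (simp add: bij_betw_def)
  then show ?thesis using that by auto
qed

text \<open>With \<open>i < p\<close> inside the index set, i may be any natural number: both sides
  are empty from row p on.\<close>

lemma entry_row_class:
  assumes b: "bij_betw T ({..<p} \<times> {..<p}) {1..p * p}" and m: "m \<le> p * p"
  shows "{k \<in> {1..m}. entry_row p T k = i} = (\<lambda>j. T (i, j)) ` {j. j < p \<and> i < p \<and> T (i, j) \<le> m}"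
proof (intro equalityI subsetI)
  fix k assume k: "k \<in> {k \<in> {1..m}. entry_row p T k = i}"
  then obtain i' j where ij: "i' < p" "j < p" "T (i', j) = k" using entry_obtain[OF b, of k] m by auto
  then have "i' = i" using entry_row_eq[OF b ij(1,2)] k by auto
  then show "k \<in> (\<lambda>j. T (i, j)) ` {j. j < p \<and> i < p \<and> T (i, j) \<le> m}" using ij k by auto
next
  fix k assume "k \<in> (\<lambda>j. T (i, j)) ` {j. j < p \<and> i < p \<and> T (i, j) \<le> m}"
  then obtain j where j: "j < p" "i < p" "T (i, j) \<le> m" "k = T (i, j)" by auto
  then have "k \<in> {1..p * p}" using b by (auto simp: bij_betw_def)
  then show "k \<in> {k \<in> {1..m}. entry_row p T k = i}" using j entry_row_eq[OF b j(2,1)] by auto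
qed

lemma card_entry_row_class:
  assumes T: "T \<in> syt (square_shape p)" and m: "m \<le> p * p"
  shows "card {k \<in> {1..m}. entry_row p T k = i} = card {j. j < p \<and> i < p \<and> T (i, j) \<le> m}"
proof -
  have b: "bij_betw T ({..<p} \<times> {..<p}) {1..p * p}" using T by (simp add: syt_square_iff)
  have "inj_on (\<lambda>j. T (i, j)) {j. j < p \<and> i < p \<and> T (i, j) \<le> m}"
    using b by (auto simp: bij_betw_def inj_on_def)
  then show ?thesis unfolding entry_row_class[OF b m] by (rule card_image)
qed

text \<open>If the entry in column j of row i + 1 is at most m, so is the entry above it; counting
  columns gives the ballot inequality for every m.\<close>

lemma reading_word_in_words:
  assumes T: "T \<in> syt (square_shape p)"
  shows "reading_word p T \<in> words (square_content p)"
proof -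
  have b: "bij_betw T ({..<p} \<times> {..<p}) {1..p * p}" using T by (simp add: syt_square_iff)
  have "ballot (reading_word p T)"
    unfolding reading_word_def ballot_reverse_word
  proof (intro allI impI)
    fix m i assume m: "m \<le> p * p"
    have "{j. j < p \<and> Suc i < p \<and> T (Suc i, j) \<le> m} \<subseteq> {j. j < p \<and> i < p \<and> T (i, j) \<le> m}"
    proof
      fix j assume j: "j \<in> {j. j < p \<and> Suc i < p \<and> T (Suc i, j) \<le> m}"
      then have "T (i, j) < T (Suc i, j)" using T unfolding syt_square_iff by blast
      then show "j \<in> {j. j < p \<and> i < p \<and> T (i, j) \<le> m}" using j by auto
    qed
    then show "card {k \<in> {1..m}. entry_row p T k = Suc i} \<le> card {k \<in> {1..m}. entry_row p T k = i}"
      unfolding card_entry_row_class[OF T m] by (intro card_mono) auto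
  qed
  moreover have "int (count_list (reading_word p T) i) = square_content p i" for i
  proof -
    have "{j. j < p \<and> i < p \<and> T (i, j) \<le> p * p} = (if i < p then {..<p} else {})"
      using b by (auto simp: bij_betw_def)
    then show ?thesis
      unfolding reading_word_def count_reverse_word card_entry_row_class[OF T order_refl]
      by (simp add: square_content_def)
  qed
  ultimately show ?thesis by (simp add: words_def)
qed

lemma descent_set_square:
  assumes T: "T \<in> syt (square_shape p)"
  shows "descent_set (square_shape p) T = {k \<in> {1..<p * p}. entry_row p T k < entry_row p T (Suc k)}"
proof -
  have b: "bij_betw T ({..<p} \<times> {..<p}) {1..p * p}" using T by (simp add: syt_square_iff)
  have rng: "i < p \<Longrightarrow> j < p \<Longrightarrow> T (i, j) \<in> {1..p * p}" for i j
    using b by (auto simp: bij_betw_def)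
  show ?thesis
  proof (intro equalityI subsetI)
    fix k assume "k \<in> descent_set (square_shape p) T"
    then obtain i j i' j' where ij: "i < p" "j < p" "i' < p" "j' < p" "T (i, j) = k" "T (i', j') = k + 1" "i < i'"
      unfolding descent_set_def diagram_square by auto
    have "entry_row p T k = i" "entry_row p T (Suc k) = i'"
      using entry_row_eq[OF b ij(1,2)] entry_row_eq[OF b ij(3,4)] ij by auto
    then show "k \<in> {k \<in> {1..<p * p}. entry_row p T k < entry_row p T (Suc k)}"
      using ij rng[OF ij(1,2)] rng[OF ij(3,4)] by auto
  next
    fix k assume k: "k \<in> {k \<in> {1..<p * p}. entry_row p T k < entry_row p T (Suc k)}"
    obtain i j where ij: "i < p" "j < p" "T (i, j) = k" using entry_obtain[OF b, of k] k by auto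
    obtain i' j' where ij': "i' < p" "j' < p" "T (i', j') = Suc k" using entry_obtain[OF b, of "Suc k"] k by auto
    have "i < i'" using k entry_row_eq[OF b ij(1,2)] entry_row_eq[OF b ij'(1,2)] ij ij' by auto
    then show "k \<in> descent_set (square_shape p) T"
      unfolding descent_set_def diagram_square using ij ij' by force
  qed
qed

lemma reverse_alternating_iff_zigzag:
  assumes T: "T \<in> syt (square_shape p)" and "odd p"
  shows "reverse_alternating (square_shape p) T \<longleftrightarrow> zigzag (reading_word p T)"
proof -
  have n: "odd (p * p)" using assms(2) by simp
  have eq: "{k \<in> A. P k} = {k. even k} \<inter> A \<longleftrightarrow> (\<forall>k\<in>A. P k \<longleftrightarrow> even k)" for A :: "nat set" and P
    by blast
  show ?thesis
    unfolding reading_word_def reverse_alternating_def descent_set_square[OF T] sum_list_square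
      zigzag_reverse_word[OF n] by (rule eq)
qed

context
  fixes p :: nat and w :: "nat list"
  assumes w: "w \<in> words (square_content p)"
begin

lemma shape_square_content: "shape p (square_content p)"
  by unfold_locales (simp add: square_content_def)

lemma length_w: "length w = p * p"
proof -
  have "int (length w) = int (p * p)"
    using shape.words_length[OF shape_square_content w] by (simp add: square_content_def)
  then show ?thesis by (simp only: of_nat_eq_iff)
qed

lemma w_eq: "w = reverse_word (\<lambda>k. w ! (p * p - k)) (p * p)"
  using reverse_word_nth[of w] length_w by simp

lemma finite_word_rows [simp]: "finite (word_rows p w i)"
  by (simp add: word_rows_def)

lemma card_word_rows: "card (word_rows p w i) = (if i < p then p else 0)"
proof -
  have "card (word_rows p w i) = count_list w i"
    unfolding word_rows_def count_reverse_word[symmetric] using w_eq by simp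
  moreover have "int (count_list w i) = square_content p i" using w by (simp add: words_def)
  ultimately show ?thesis by (auto simp: square_content_def split: if_splits)
qed

lemma word_rows_mono:
  assumes "i \<le> i'" "m \<le> p * p"
  shows "card {k \<in> word_rows p w i'. k \<le> m} \<le> card {k \<in> word_rows p w i. k \<le> m}"
proof -
  have "{k \<in> word_rows p w i. k \<le> m} = {k \<in> {1..m}. w ! (p * p - k) = i}" for i
    using assms(2) by (auto simp: word_rows_def)
  moreover have "ballot (reverse_word (\<lambda>k. w ! (p * p - k)) (p * p))"
    using w w_eq by (simp add: words_def)
  ultimately have step: "card {k \<in> word_rows p w (Suc i). k \<le> m} \<le> card {k \<in> word_rows p w i. k \<le> m}" for i
    using assms(2) unfolding ballot_reverse_word by simp
  show ?thesis using lift_Suc_antimono_le[of "\<lambda>i. card {k \<in> word_rows p w i. k \<le> m}", OF step assms(1)] .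
qed

lemma word_tableau_nth:
  assumes "i < p" "j < p"
  shows "word_tableau p w (i, j) = sorted_list_of_set (word_rows p w i) ! j"
    and "word_tableau p w (i, j) \<in> word_rows p w i"
proof -
  show *: "word_tableau p w (i, j) = sorted_list_of_set (word_rows p w i) ! j"
    using assms by (simp add: word_tableau_def)
  have "sorted_list_of_set (word_rows p w i) ! j \<in> set (sorted_list_of_set (word_rows p w i))"
    using assms card_word_rows[of i] by (intro nth_mem) simp
  then show "word_tableau p w (i, j) \<in> word_rows p w i" unfolding * by simp
qed

lemma word_tableau_syt: "word_tableau p w \<in> syt (square_shape p)"
  unfolding syt_square_iff
proof (intro conjI allI impI)
  let ?T = "word_tableau p w"
  show "?T \<in> extensional ({..<p} \<times> {..<p})" by (simp add: word_tableau_def)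
  show "?T (i, j) < ?T (i, j')" if "i < p \<and> j < j' \<and> j' < p" for i j j'
    using that card_word_rows[of i] strict_sorted_list_of_set[of "word_rows p w i"]
    by (simp add: word_tableau_nth sorted_wrt_iff_nth_less)
  show "?T (i, j) < ?T (i', j)" if "i < i' \<and> i' < p \<and> j < p" for i i' j
  proof -
    have i: "i < p" "i' < p" "j < p" "i < i'" using that by auto
    let ?m = "?T (i', j)"
    have m: "?m \<in> word_rows p w i'" by (rule word_tableau_nth) (use i in auto)
    \<comment> \<open>Row i' has more than j entries up to ?m, hence so has the higher row i, and
      its entry in column j is at most ?m. Equality is excluded because the rows have disjoint entry
      sets.\<close>
    have "j < card {k \<in> word_rows p w i'. k \<le> ?m}"
      using sorted_list_of_set_nth_le_iff[of "word_rows p w i'" j ?m] i card_word_rows[of i']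
      by (simp add: word_tableau_nth)
    also have "\<dots> \<le> card {k \<in> word_rows p w i. k \<le> ?m}"
      using m i by (intro word_rows_mono) (auto simp: word_rows_def)
    finally have "?T (i, j) \<le> ?m"
      using sorted_list_of_set_nth_le_iff[of "word_rows p w i" j ?m] i card_word_rows[of i]
      by (simp add: word_tableau_nth)
    moreover have "?T (i, j) \<noteq> ?m"
      using m word_tableau_nth(2)[of i j] i by (auto simp: word_rows_def)
    ultimately show ?thesis by simp
  qed
  show "bij_betw ?T ({..<p} \<times> {..<p}) {1..p * p}"
    unfolding bij_betw_def
  proof
    show "inj_on ?T ({..<p} \<times> {..<p})"
    proof (rule inj_onI)
      fix a b assume ab: "a \<in> {..<p} \<times> {..<p}" "b \<in> {..<p} \<times> {..<p}" "?T a = ?T b"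
      obtain i j i' j' where e: "a = (i, j)" "b = (i', j')" by (cases a, cases b)
      have l: "i < p" "j < p" "i' < p" "j' < p" using ab e by auto
      have "?T (i, j) \<in> word_rows p w i" "?T (i', j') \<in> word_rows p w i'"
        using word_tableau_nth(2) l by auto
      then have ii: "i = i'" using ab(3) e by (auto simp: word_rows_def)
      have "sorted_list_of_set (word_rows p w i) ! j = sorted_list_of_set (word_rows p w i) ! j'"
        using ab(3) l ii unfolding e by (simp add: word_tableau_nth(1))
      then have "j = j'"
        using nth_eq_iff_index_eq[of "sorted_list_of_set (word_rows p w i)" j j'] l card_word_rows[of i] by simp
      then show "a = b" using e ii by simp
    qed
    show "?T ` ({..<p} \<times> {..<p}) = {1..p * p}"
    proof (intro equalityI subsetI)
      fix k assume "k \<in> ?T ` ({..<p} \<times> {..<p})"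
      then obtain i j where "i < p" "j < p" "k = ?T (i, j)" by auto
      then show "k \<in> {1..p * p}" using word_tableau_nth(2)[of i j] by (auto simp: word_rows_def)
    next
      fix k assume k: "k \<in> {1..p * p}"
      define i where "i = w ! (p * p - k)"
      have kr: "k \<in> word_rows p w i" using k by (simp add: word_rows_def i_def)
      then have "card (word_rows p w i) \<noteq> 0" by (metis card_0_eq empty_iff finite_word_rows)
      then have i: "i < p" using card_word_rows[of i] by (auto split: if_splits)
      have "k \<in> set (sorted_list_of_set (word_rows p w i))" using kr by simp
      then obtain j where "j < p" "k = sorted_list_of_set (word_rows p w i) ! j"
        unfolding in_set_conv_nth using card_word_rows[of i] i by auto
      then have "k = ?T (i, j)" "j < p" using i by (auto simp: word_tableau_nth)
      then show "k \<in> ?T ` ({..<p} \<times> {..<p})" using i by auto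
    qed
  qed
qed

lemma reading_word_word_tableau: "reading_word p (word_tableau p w) = w"
proof -
  let ?T = "word_tableau p w"
  have b: "bij_betw ?T ({..<p} \<times> {..<p}) {1..p * p}" using word_tableau_syt by (simp add: syt_square_iff)
  have "reading_word p ?T = reverse_word (\<lambda>k. w ! (p * p - k)) (p * p)"
    unfolding reading_word_def
  proof (rule reverse_word_cong)
    fix k assume "k \<in> {1..p * p}"
    then obtain i j where ij: "i < p" "j < p" "?T (i, j) = k" using entry_obtain[OF b] by metis
    then show "entry_row p ?T k = w ! (p * p - k)"
      using entry_row_eq[OF b ij(1,2)] word_tableau_nth(2)[OF ij(1,2)] by (auto simp: word_rows_def)
  qed
  then show ?thesis using w_eq by simp
qed

end

text \<open>The word determines the set of entries of each row, and rows are increasing, so sorting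
  recovers them.\<close>

lemma word_tableau_reading_word:
  assumes T: "T \<in> syt (square_shape p)"
  shows "word_tableau p (reading_word p T) = T"
proof (rule extensionalityI[of _ "{..<p} \<times> {..<p}"])
  have b: "bij_betw T ({..<p} \<times> {..<p}) {1..p * p}" using T by (simp add: syt_square_iff)
  show "word_tableau p (reading_word p T) \<in> extensional ({..<p} \<times> {..<p})"
    by (simp add: word_tableau_def)
  show "T \<in> extensional ({..<p} \<times> {..<p})" using T by (simp add: syt_square_iff)
  fix a assume a: "a \<in> {..<p} \<times> {..<p}"
  then obtain i j where ij: "a = (i, j)" "i < p" "j < p" by auto
  have "word_rows p (reading_word p T) i = {k \<in> {1..p * p}. entry_row p T k = i}"
    unfolding word_rows_def reading_word_def
    by (rule Collect_cong, rule conj_cong) (auto simp: nth_reverse_word)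
  also have "\<dots> = (\<lambda>j. T (i, j)) ` {..<p}"
  proof -
    have "{j. j < p \<and> i < p \<and> T (i, j) \<le> p * p} = {..<p}"
      using syt_square_range[OF T ij(2)] ij(2) by auto
    then show ?thesis unfolding entry_row_class[OF b order_refl] by simp
  qed
  finally have R: "word_rows p (reading_word p T) i = set (map (\<lambda>j. T (i, j)) [0..<p])"
    by (simp add: atLeast0LessThan)
  have "sorted_wrt (<) (map (\<lambda>j. T (i, j)) [0..<p])"
    using T ij unfolding syt_square_iff by (auto simp: sorted_wrt_iff_nth_less)
  then have "sorted_list_of_set (set (map (\<lambda>j. T (i, j)) [0..<p])) = map (\<lambda>j. T (i, j)) [0..<p]"
    by (intro sorted_list_of_set.idem_if_sorted_distinct) (auto simp: strict_sorted_iff)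
  then show "word_tableau p (reading_word p T) a = T a"
    using ij R by (simp add: word_tableau_def)
qed

lemma ralt_square_eq_card_words:
  assumes "odd p"
  shows "ralt (square_shape p) = card {w \<in> words (square_content p). zigzag w}"
  unfolding ralt_def
proof (rule bij_betw_same_card, rule bij_betw_byWitness[where f = "reading_word p" and f' = "word_tableau p"])
  show "\<forall>T\<in>{T \<in> syt (square_shape p). reverse_alternating (square_shape p) T}. word_tableau p (reading_word p T) = T"
    by (simp add: word_tableau_reading_word)
  show "\<forall>w\<in>{w \<in> words (square_content p). zigzag w}. reading_word p (word_tableau p w) = w"
    by (simp add: reading_word_word_tableau)
  show "reading_word p ` {T \<in> syt (square_shape p). reverse_alternating (square_shape p) T}
      \<subseteq> {w \<in> words (square_content p). zigzag w}"
    using reading_word_in_words reverse_alternating_iff_zigzag[OF _ assms] by blast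
  show "word_tableau p ` {w \<in> words (square_content p). zigzag w}
      \<subseteq> {T \<in> syt (square_shape p). reverse_alternating (square_shape p) T}"
  proof (rule image_subsetI)
    fix w assume "w \<in> {w \<in> words (square_content p). zigzag w}"
    then have w: "w \<in> words (square_content p)" "zigzag w" by auto
    have "reverse_alternating (square_shape p) (word_tableau p w)"
      unfolding reverse_alternating_iff_zigzag[OF word_tableau_syt[OF w(1)] assms]
        reading_word_word_tableau[OF w(1)] by (rule w(2))
    then show "word_tableau p w \<in> {T \<in> syt (square_shape p). reverse_alternating (square_shape p) T}"
      using word_tableau_syt[OF w(1)] by blast
  qed
qed

section \<open>Half turn and complementation of square tableaux\<close>

definition rotate_tableau :: "nat \<Rightarrow> (nat \<times> nat \<Rightarrow> nat) \<Rightarrow> nat \<times> nat \<Rightarrow> nat" where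
  "rotate_tableau p T = restrict (\<lambda>(i, j). p * p + 1 - T (p - 1 - i, p - 1 - j)) ({..<p} \<times> {..<p})"

lemma complement_strict_antimono: "a < b \<Longrightarrow> b \<in> {1..n} \<Longrightarrow> n + 1 - b < n + 1 - (a::nat)"
  by auto

lemma complement_involution: "k \<in> {1..n} \<Longrightarrow> n + 1 - (n + 1 - k) = (k::nat)"
  by auto

lemma bij_betw_complement: "bij_betw (\<lambda>k::nat. n + 1 - k) {1..n} {1..n}"
  by (rule bij_betw_byWitness[where f' = "\<lambda>k. n + 1 - k"]) auto

lemma rotate_tableau_apply:
  "i < p \<Longrightarrow> j < p \<Longrightarrow> rotate_tableau p T (i, j) = p * p + 1 - T (p - 1 - i, p - 1 - j)"
  by (simp add: rotate_tableau_def)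

lemma rotate_tableau_syt:
  assumes T: "T \<in> syt (square_shape p)"
  shows "rotate_tableau p T \<in> syt (square_shape p)"
  unfolding syt_square_iff
proof (intro conjI allI impI)
  let ?R = "rotate_tableau p T"
  let ?D = "{..<p} \<times> {..<p}"
  show "?R \<in> extensional ?D" by (simp add: rotate_tableau_def)
  have row: "T (i, j) < T (i, j')" if "i < p" "j < j'" "j' < p" for i j j'
    using T that unfolding syt_square_iff by blast
  have col: "T (i, j) < T (i', j)" if "i < i'" "i' < p" "j < p" for i i' j
    using T that unfolding syt_square_iff by blast
  show "?R (i, j) < ?R (i, j')" if "i < p \<and> j < j' \<and> j' < p" for i j j'
  proof -
    have "T (p - 1 - i, p - 1 - j') < T (p - 1 - i, p - 1 - j)" using that by (intro row) auto
    moreover have "T (p - 1 - i, p - 1 - j) \<in> {1..p * p}" using that by (intro syt_square_range[OF T]) auto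
    ultimately have "p * p + 1 - T (p - 1 - i, p - 1 - j) < p * p + 1 - T (p - 1 - i, p - 1 - j')"
      by (rule complement_strict_antimono)
    then show ?thesis using that by (simp add: rotate_tableau_apply)
  qed
  show "?R (i, j) < ?R (i', j)" if "i < i' \<and> i' < p \<and> j < p" for i i' j
  proof -
    have "T (p - 1 - i', p - 1 - j) < T (p - 1 - i, p - 1 - j)" using that by (intro col) auto
    moreover have "T (p - 1 - i, p - 1 - j) \<in> {1..p * p}" using that by (intro syt_square_range[OF T]) auto
    ultimately have "p * p + 1 - T (p - 1 - i, p - 1 - j) < p * p + 1 - T (p - 1 - i', p - 1 - j)"
      by (rule complement_strict_antimono)
    then show ?thesis using that by (simp add: rotate_tableau_apply)
  qed
  have r1: "bij_betw (\<lambda>(i, j). (p - 1 - i, p - 1 - j)) ?D ?D"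
    by (rule bij_betw_byWitness[where f' = "\<lambda>(i, j). (p - 1 - i, p - 1 - j)"]) auto
  have r2: "bij_betw T ?D {1..p * p}" using T by (simp add: syt_square_iff)
  have "bij_betw ((\<lambda>k. p * p + 1 - k) \<circ> (T \<circ> (\<lambda>(i, j). (p - 1 - i, p - 1 - j)))) ?D {1..p * p}"
    by (rule bij_betw_trans[OF bij_betw_trans[OF r1 r2] bij_betw_complement])
  moreover have "((\<lambda>k. p * p + 1 - k) \<circ> (T \<circ> (\<lambda>(i, j). (p - 1 - i, p - 1 - j)))) a = ?R a" if "a \<in> ?D" for a
    using that by (auto simp: rotate_tableau_apply)
  ultimately show "bij_betw ?R ?D {1..p * p}"
    using bij_betw_cong by blast
qed

lemma rotate_tableau_involution:
  assumes T: "T \<in> syt (square_shape p)"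
  shows "rotate_tableau p (rotate_tableau p T) = T"
proof (rule extensionalityI[of _ "{..<p} \<times> {..<p}"])
  show "rotate_tableau p (rotate_tableau p T) \<in> extensional ({..<p} \<times> {..<p})"
    by (simp add: rotate_tableau_def)
  show "T \<in> extensional ({..<p} \<times> {..<p})" using T by (simp add: syt_square_iff)
  fix a assume "a \<in> {..<p} \<times> {..<p}"
  then obtain i j where ij: "a = (i, j)" "i < p" "j < p" by auto
  then have "rotate_tableau p (rotate_tableau p T) a = p * p + 1 - (p * p + 1 - T (i, j))"
    by (simp add: rotate_tableau_apply)
  then show "rotate_tableau p (rotate_tableau p T) a = T a"
    unfolding complement_involution[OF syt_square_range[OF T ij(2,3)]] ij(1) .
qed

text \<open>The entries k and k + 1 become p * p + 1 - k and p * p - k. The half turn reverses the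
  order of their rows, so the smaller new entry is again the higher one.\<close>

lemma rotate_tableau_descent:
  assumes T: "T \<in> syt (square_shape p)" and k: "k \<in> descent_set (square_shape p) T"
  shows "p * p - k \<in> descent_set (square_shape p) (rotate_tableau p T)"
proof -
  obtain i j i' j' where ij: "i < p" "j < p" "i' < p" "j' < p" "T (i, j) = k" "T (i', j') = k + 1" "i < i'"
    using k unfolding descent_set_def diagram_square by auto
  have kk: "k + 1 \<le> p * p" using syt_square_range[OF T ij(3,4)] ij by auto
  have "rotate_tableau p T (p - 1 - i', p - 1 - j') = p * p - k"
       "rotate_tableau p T (p - 1 - i, p - 1 - j) = p * p - k + 1"
    using ij kk by (simp_all add: rotate_tableau_apply Suc_diff_le)
  moreover have "p - 1 - i' < p - 1 - i" using ij by auto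
  ultimately show ?thesis
    unfolding descent_set_def diagram_square using ij(1-4)
    by (intro CollectI bexI[of _ "(p - 1 - i', p - 1 - j')"] case_prodI bexI[of _ "(p - 1 - i, p - 1 - j)"]) auto
qed

text \<open>The inclusion not given by \<open>rotate_tableau_descent\<close> follows by applying it
  to the rotated tableau, since rotation is an involution.\<close>

lemma rotate_tableau_descent_set:
  assumes T: "T \<in> syt (square_shape p)"
  shows "descent_set (square_shape p) (rotate_tableau p T) = (\<lambda>k. p * p - k) ` descent_set (square_shape p) T"
proof (intro equalityI subsetI)
  fix k assume k: "k \<in> descent_set (square_shape p) (rotate_tableau p T)"
  have "k < p * p" using k descent_set_square[OF rotate_tableau_syt[OF T]] by auto
  moreover have "p * p - k \<in> descent_set (square_shape p) T"
    using rotate_tableau_descent[OF rotate_tableau_syt[OF T] k] rotate_tableau_involution[OF T] by simp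
  ultimately show "k \<in> (\<lambda>k. p * p - k) ` descent_set (square_shape p) T"
    by (intro image_eqI[of _ _ "p * p - k"]) auto
next
  fix k assume "k \<in> (\<lambda>k. p * p - k) ` descent_set (square_shape p) T"
  then show "k \<in> descent_set (square_shape p) (rotate_tableau p T)"
    using rotate_tableau_descent[OF T] by auto
qed

text \<open>As p * p is odd, k and p * p - k have opposite parity, so rotation exchanges the two
  prescribed descent sets.\<close>

lemma alt_square_eq_ralt_square:
  assumes "odd p"
  shows "alt (square_shape p) = ralt (square_shape p)"
  unfolding alt_def ralt_def
proof (rule bij_betw_same_card, rule bij_betw_byWitness[where f = "rotate_tableau p" and f' = "rotate_tableau p"])
  have n: "odd (p * p)" using assms by simp
  have image_refl: "(\<lambda>k. p * p - k) ` ({k. P k} \<inter> {1..<p * p}) = {k. \<not> P k} \<inter> {1..<p * p}"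
    if P: "\<And>k. k < p * p \<Longrightarrow> P (p * p - k) \<longleftrightarrow> \<not> P k" for P
  proof (intro equalityI subsetI)
    fix k assume "k \<in> (\<lambda>k. p * p - k) ` ({k. P k} \<inter> {1..<p * p})"
    then obtain l where "P l" "l \<in> {1..<p * p}" "k = p * p - l" by blast
    then show "k \<in> {k. \<not> P k} \<inter> {1..<p * p}" using P[of l] by auto
  next
    fix k assume "k \<in> {k. \<not> P k} \<inter> {1..<p * p}"
    then have "\<not> P k" "1 \<le> k" "k < p * p" by auto
    then show "k \<in> (\<lambda>k. p * p - k) ` ({k. P k} \<inter> {1..<p * p})"
      using P[of k] by (intro image_eqI[of _ _ "p * p - k"]) auto
  qed
  have parity: "k < p * p \<Longrightarrow> odd (p * p - k) \<longleftrightarrow> \<not> odd k" for k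
    using n by (metis even_add le_add_diff_inverse less_imp_le)
  have reflect: "(\<lambda>k. p * p - k) ` ({k. odd k} \<inter> {1..<p * p}) = {k. even k} \<inter> {1..<p * p}"
             "(\<lambda>k. p * p - k) ` ({k. even k} \<inter> {1..<p * p}) = {k. odd k} \<inter> {1..<p * p}"
    using image_refl[of odd] image_refl[of even] parity assms by simp_all
  show "rotate_tableau p ` {T \<in> syt (square_shape p). alternating (square_shape p) T}
      \<subseteq> {T \<in> syt (square_shape p). reverse_alternating (square_shape p) T}"
  proof (rule image_subsetI)
    fix T assume "T \<in> {T \<in> syt (square_shape p). alternating (square_shape p) T}"
    then have T: "T \<in> syt (square_shape p)" and D: "alternating (square_shape p) T" by auto
    have "reverse_alternating (square_shape p) (rotate_tableau p T)"
      unfolding reverse_alternating_def rotate_tableau_descent_set[OF T] D[unfolded alternating_def]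
        sum_list_square by (rule reflect(1))
    then show "rotate_tableau p T \<in> {T \<in> syt (square_shape p). reverse_alternating (square_shape p) T}"
      using rotate_tableau_syt[OF T] by blast
  qed
  show "rotate_tableau p ` {T \<in> syt (square_shape p). reverse_alternating (square_shape p) T}
      \<subseteq> {T \<in> syt (square_shape p). alternating (square_shape p) T}"
  proof (rule image_subsetI)
    fix T assume "T \<in> {T \<in> syt (square_shape p). reverse_alternating (square_shape p) T}"
    then have T: "T \<in> syt (square_shape p)" and D: "reverse_alternating (square_shape p) T" by auto
    have "alternating (square_shape p) (rotate_tableau p T)"
      unfolding alternating_def rotate_tableau_descent_set[OF T] D[unfolded reverse_alternating_def]
        sum_list_square by (rule reflect(2))
    then show "rotate_tableau p T \<in> {T \<in> syt (square_shape p). alternating (square_shape p) T}"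
      using rotate_tableau_syt[OF T] by blast
  qed
qed (auto simp: rotate_tableau_involution)

subsection \<open>The square determinant\<close>

lemma hook_length_square:
  assumes "i < p" "j < p"
  shows "hook_length (square_shape p) (i, j) = (p - Suc i) + (p - Suc j) + 1"
proof -
  have "{(i', j') \<in> diagram (square_shape p). i' = i \<and> j \<le> j' \<or> j' = j \<and> i \<le> i'}
      = ({i} \<times> {j..<p}) \<union> ({Suc i..<p} \<times> {j})"
    using assms by (auto simp: diagram_square le_eq_less_or_eq)
  then have "hook_length (square_shape p) (i, j) = card (({i} \<times> {j..<p}) \<union> ({Suc i..<p} \<times> {j}))"
    by (simp add: hook_length_def)
  also have "\<dots> = card ({i} \<times> {j..<p}) + card ({Suc i..<p} \<times> {j})"
    by (rule card_Un_disjoint) auto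
  finally show ?thesis using assms by simp
qed

lemma hook_product_square: "hook_product (square_shape p) = (\<Prod>i<p. \<Prod>j<p. i + j + 1)"
proof -
  have "hook_product (square_shape p) = (\<Prod>(i, j)\<in>{..<p} \<times> {..<p}. (p - Suc i) + (p - Suc j) + 1)"
    unfolding hook_product_def diagram_square
    by (rule prod.cong) (auto simp: hook_length_square)
  also have "\<dots> = (\<Prod>i<p. \<Prod>j<p. (p - Suc i) + (p - Suc j) + 1)"
    by (rule prod.cartesian_product[symmetric])
  also have "\<dots> = (\<Prod>i<p. \<Prod>j<p. (p - Suc i) + j + 1)"
    by (rule prod.cong[OF refl]) (rule prod.nat_diff_reindex)
  also have "\<dots> = (\<Prod>i<p. \<Prod>j<p. i + j + 1)"
    by (rule prod.nat_diff_reindex)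
  finally show ?thesis .
qed

text \<open>Passing from p to p + 1 adds a border row and column, each contributing (2 p)! / p!, and
  the corner 2 p + 1. The factors are the reciprocals of the factorial quotients in
  \<open>hankel_det\<close>.\<close>

lemma hook_product_square_fact:
  "(of_nat (hook_product (square_shape p)) :: complex) =
     (\<Prod>k<p. fact (2 * k) * fact (2 * k + 1) / (fact k)\<^sup>2)"
proof -
  have rising: "(\<Prod>j<m. of_nat (p + j + 1)) * fact p = (fact (p + m) :: complex)" for p m
  proof (induction m)
    case (Suc m)
    have "(\<Prod>j<Suc m. of_nat (p + j + 1)) * fact p
        = of_nat (p + m + 1) * ((\<Prod>j<m. of_nat (p + j + 1)) * fact p :: complex)"
      by (simp only: prod.lessThan_Suc mult_ac)
    then show ?case unfolding Suc by simp
  qed simp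
  have "(\<Prod>i<p. \<Prod>j<p. (of_nat (i + j + 1) :: complex)) =
     (\<Prod>k<p. fact (2 * k) * fact (2 * k + 1) / (fact k)\<^sup>2)"
  proof (induction p)
    case (Suc p)
    have r: "(\<Prod>j<p. of_nat (p + j + 1)) = (fact (2 * p) / fact p :: complex)"
      unfolding mult_2 rising[symmetric] by simp
    have "(\<Prod>i<Suc p. \<Prod>j<Suc p. (of_nat (i + j + 1) :: complex))
       = (\<Prod>i<p. \<Prod>j<p. of_nat (i + j + 1)) * (\<Prod>i<p. of_nat (i + p + 1)) *
         ((\<Prod>j<p. of_nat (p + j + 1)) * of_nat (p + p + 1))"
      by (simp only: prod.lessThan_Suc prod.distrib mult_ac)
    also have "(\<Prod>i<p. of_nat (i + p + 1)) = (\<Prod>j<p. (of_nat (p + j + 1) :: complex))"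
      by (rule prod.cong) (auto simp: add.commute)
    also have "(\<Prod>i<p. \<Prod>j<p. of_nat (i + j + 1)) * (\<Prod>j<p. of_nat (p + j + 1)) *
         ((\<Prod>j<p. of_nat (p + j + 1)) * of_nat (p + p + 1)) =
        (\<Prod>k<p. fact (2 * k) * fact (2 * k + 1) / (fact k)\<^sup>2) *
        (fact (2 * p) * fact (2 * p + 1) / (fact p)\<^sup>2 :: complex)"
      unfolding r Suc by (simp add: power2_eq_square mult_ac)
    finally show ?case by (simp only: prod.lessThan_Suc)
  qed simp
  then show ?thesis unfolding hook_product_square by simp
qed

section \<open>From the Jacobi-Trudi matrix of the square to the Hankel matrix\<close>

definition exchange_mat :: "nat \<Rightarrow> 'a::comm_ring_1 mat" where
  "exchange_mat p = mat p p (\<lambda>(i, j). of_bool (i + j + 1 = p))"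

text \<open>Row 0 has a single nonzero entry, in the last column; deleting both leaves the exchange
  matrix of size p.\<close>

lemma det_exchange_mat: "det (exchange_mat p :: 'a::comm_ring_1 mat) = (\<Prod>k<p. (-1) ^ k)"
proof (induction p)
  case 0
  show ?case by (simp add: exchange_mat_def)
next
  case (Suc p)
  let ?J = "exchange_mat (Suc p) :: 'a mat"
  have "det ?J = (\<Sum>j<Suc p. ?J $$ (0, j) * cofactor ?J 0 j)"
    by (rule laplace_expansion_row) (auto simp: exchange_mat_def)
  also have "\<dots> = (\<Sum>j\<in>{p}. ?J $$ (0, j) * cofactor ?J 0 j)"
    by (rule sum.mono_neutral_right) (auto simp: exchange_mat_def)
  also have "\<dots> = (-1) ^ p * det (mat_delete ?J 0 p)"
    by (simp add: exchange_mat_def cofactor_def)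
  also have "mat_delete ?J 0 p = exchange_mat p"
    by (rule eq_matI) (auto simp: exchange_mat_def mat_delete_def)
  finally show ?case using Suc by (simp add: mult.commute)
qed

text \<open>Row i has the entries f (p - i + j); replacing i by p - 1 - i turns them into f (i + j +
  1).\<close>

lemma jacobi_trudi_square:
  "jacobi_trudi p f (square_content p) = (\<Prod>k<p. (-1) ^ k) * det (mat p p (\<lambda>(i, j). f (int (i + j) + 1)))"
proof -
  let ?H = "mat p p (\<lambda>(i, j). f (int (i + j) + 1))"
  have "mat p p (\<lambda>(i, j). f (square_content p i - int i + int j)) = exchange_mat p * ?H"
  proof (rule eq_matI)
    fix i j assume "i < dim_row (exchange_mat p * ?H)" "j < dim_col (exchange_mat p * ?H)"
    then have ij: "i < p" "j < p" by (auto simp: exchange_mat_def)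
    have "(exchange_mat p * ?H) $$ (i, j) = (\<Sum>k<p. of_bool (i + k + 1 = p) * f (int (k + j) + 1))"
      using ij by (simp add: exchange_mat_def scalar_prod_def atLeast0LessThan)
    also have "\<dots> = (\<Sum>k\<in>{p - 1 - i}. of_bool (i + k + 1 = p) * f (int (k + j) + 1))"
      by (rule sum.mono_neutral_right) (use ij in auto)
    also have "\<dots> = f (int (p - 1 - i + j) + 1)" using ij by simp
    also have "int (p - 1 - i + j) + 1 = square_content p i - int i + int j"
      using ij by (simp add: square_content_def of_nat_diff)
    finally show "mat p p (\<lambda>(i, j). f (square_content p i - int i + int j)) $$ (i, j) = (exchange_mat p * ?H) $$ (i, j)"
      using ij by simp
  qed (auto simp: exchange_mat_def)
  then show ?thesis
    unfolding jacobi_trudi_def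
    by (simp add: det_mult[of _ p] det_exchange_mat[symmetric] exchange_mat_def)
qed

text \<open>The factor \<open>g j\<close> occurs once for each k from j to p - 1, that is p - j
  times.\<close>

lemma prod_triangle:
  fixes g :: "nat \<Rightarrow> 'a::comm_monoid_mult"
  shows "(\<Prod>k<p. \<Prod>j=1..k. g j) = (\<Prod>j\<in>{1..<p}. g j ^ (p - j))"
proof (induction p)
  case (Suc p)
  have "(\<Prod>j\<in>{1..<Suc p}. g j ^ (Suc p - j)) = (\<Prod>j\<in>{1..<Suc p}. g j ^ (p - j) * g j)"
    by (rule prod.cong) (auto simp: Suc_diff_le mult.commute)
  also have "\<dots> = (\<Prod>j\<in>{1..<Suc p}. g j ^ (p - j)) * (\<Prod>j\<in>{1..<Suc p}. g j)"
    by (rule prod.distrib)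
  \<comment> \<open>The additional index j = p has exponent 0.\<close>
  also have "(\<Prod>j\<in>{1..<Suc p}. g j ^ (p - j)) = (\<Prod>j\<in>{1..<p}. g j ^ (p - j))"
    by (rule prod.mono_neutral_right) auto
  also have "(\<Prod>j\<in>{1..<Suc p}. g j) = (\<Prod>j=1..p. g j)"
    by (simp add: atLeastLessThanSuc_atLeastAtMost)
  finally show ?case unfolding prod.lessThan_Suc Suc by (rule sym)
qed simp

text \<open>The signs of \<open>hankel_det\<close> cancel against those of the row reversal, its
  factorials combine to the hook product, and \<open>prod_triangle\<close> collects the quadratic
  factors.\<close>

lemma poly_jacobi_trudi_square:
  "poly (jacobi_trudi p atan_coeff (square_content p)) E =
     E ^ p * (\<Prod>j\<in>{1..<p}. (E\<^sup>2 + (2 * of_nat j)\<^sup>2) ^ (p - j)) / of_nat (hook_product (square_shape p))"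
proof -
  have H: "mat p p (\<lambda>(i, j). poly (atan_coeff (int (i + j) + 1)) E) = mat p p (\<lambda>(i, j). atan_moments.m E (i + j))"
  proof (rule cong_mat)
    have "nat (int n + 1) = Suc n" for n by simp
    then have "poly (atan_coeff (int n + 1)) E = atan_moments.m E n" for n
      unfolding atan_coeff_def atan_moments.m_def by simp
    then show "(case (i, j) of (i, j) \<Rightarrow> poly (atan_coeff (int (i + j) + 1)) E)
        = (case (i, j) of (i, j) \<Rightarrow> atan_moments.m E (i + j))" for i j
      unfolding prod.case .
  qed auto
  have "poly (jacobi_trudi p atan_coeff (square_content p)) E =
     (\<Prod>k<p. (-1) ^ k) * (\<Prod>k<p. (-1) ^ k * (fact k)\<^sup>2 / (fact (2 * k) * fact (2 * k + 1)) *
        (E * (\<Prod>j=1..k. E\<^sup>2 + (2 * of_nat j)\<^sup>2)))"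
    unfolding poly_jacobi_trudi unfolding jacobi_trudi_square H atan_moments.hankel_det ..
  also have "\<dots> = (\<Prod>k<p. (-1) ^ k * ((-1) ^ k * (fact k)\<^sup>2 / (fact (2 * k) * fact (2 * k + 1)) *
        (E * (\<Prod>j=1..k. E\<^sup>2 + (2 * of_nat j)\<^sup>2))))"
    by (rule prod.distrib[symmetric])
  also have "\<dots> = (\<Prod>k<p. (E * (\<Prod>j=1..k. E\<^sup>2 + (2 * of_nat j)\<^sup>2)) /
     (fact (2 * k) * fact (2 * k + 1) / (fact k)\<^sup>2))"
  proof (rule prod.cong[OF refl])
    fix k
    have "(-1) ^ k * ((-1) ^ k * a / b * c) = c / (b / a)" for a b c :: complex
      by (cases "even k") simp_all
    then show "(-1) ^ k * ((-1) ^ k * (fact k)\<^sup>2 / (fact (2 * k) * fact (2 * k + 1)) *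
        (E * (\<Prod>j=1..k. E\<^sup>2 + (2 * of_nat j)\<^sup>2))) =
      (E * (\<Prod>j=1..k. E\<^sup>2 + (2 * of_nat j)\<^sup>2)) / (fact (2 * k) * fact (2 * k + 1) / (fact k)\<^sup>2)" .
  qed
  also have "\<dots> = (\<Prod>k<p. E * (\<Prod>j=1..k. E\<^sup>2 + (2 * of_nat j)\<^sup>2)) / of_nat (hook_product (square_shape p))"
    unfolding hook_product_square_fact by (rule prod_dividef)
  also have "(\<Prod>k<p. E * (\<Prod>j=1..k. E\<^sup>2 + (2 * of_nat j)\<^sup>2)) =
     E ^ p * (\<Prod>j\<in>{1..<p}. (E\<^sup>2 + (2 * of_nat j)\<^sup>2) ^ (p - j))"
    unfolding prod.distrib prod_triangle by simp
  finally show ?thesis .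
qed

lemma umbral_map_poly: "umbral (map_poly of_real P) = of_real (umbral_eval P)"
  by (simp add: umbral_def moment_functional_def umbral_eval_def coeff_map_poly degree_map_poly)

lemma poly_square_numerator:
  fixes E :: complex
  shows "poly (map_poly of_real (square_numerator p)) E =
     E ^ p * (\<Prod>j\<in>{1..<p}. (E\<^sup>2 + (2 * of_nat j)\<^sup>2) ^ (p - j))"
proof -
  have m: "map_poly complex_of_real (monom 1 1) = [:0, 1:]"
    by (simp add: map_poly_monom monom_altdef)
  have c: "map_poly complex_of_real [:c:] = [:of_real c:]" for c
    by (rule poly_eqI) (simp add: coeff_map_poly coeff_pCons split: nat.splits)
  have e: "complex_of_real ((2 * real i)\<^sup>2) = (2 * of_nat i)\<^sup>2" for i
    by simp
  interpret of_real_poly: map_poly_comm_ring_hom "of_real :: real \<Rightarrow> complex"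
    by unfold_locales auto
  have "map_poly complex_of_real (square_numerator p) =
      [:0, 1:] ^ p * (\<Prod>i\<in>{1..<p}. ([:0, 1:] ^ 2 + [:(2 * of_nat i)\<^sup>2:]) ^ (p - i))"
    unfolding square_numerator_def of_real_poly.hom_mult of_real_poly.hom_prod
      of_real_poly.hom_power of_real_poly.hom_add m c e by (rule refl)
  then show ?thesis
    by (simp only: poly_mult poly_power poly_prod poly_add poly_pCons poly_0
        mult_zero_right add_0_right add_0_left mult_1_right)
qed

theorem theorem4p4:
  fixes p :: nat
  assumes "odd p"
  shows "alt (square_shape p) = ralt (square_shape p) \<and>
    real (alt (square_shape p)) =
      umbral_eval (square_numerator p) / real (hook_product (square_shape p))"
proof
  show eq: "alt (square_shape p) = ralt (square_shape p)"
    by (rule alt_square_eq_ralt_square[OF assms])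
  let ?h = "of_nat (hook_product (square_shape p)) :: complex"
  \<comment> \<open>Agreement at every complex E gives equality of polynomials. This is required
    before evaluating, because umbral evaluation acts on coefficients.\<close>
  have jt: "jacobi_trudi p atan_coeff (square_content p) = smult (1 / ?h) (map_poly of_real (square_numerator p))"
    by (rule poly_ext) (simp add: poly_jacobi_trudi_square poly_square_numerator)
  have "dominant p (square_content p)"
    by (simp add: dominant_def square_content_def)
  moreover have "odd (\<Sum>i<p. square_content p i)"
    using assms by (simp add: square_content_def)
  moreover have "shape p (square_content p)"
    by unfold_locales (simp add: square_content_def)
  ultimately have "of_nat (ralt (square_shape p)) = umbral (jacobi_trudi p atan_coeff (square_content p))"
    unfolding ralt_square_eq_card_words[OF assms] by (intro card_zigzag_words)
  also have "\<dots> = of_real (umbral_eval (square_numerator p)) / ?h"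
    unfolding jt umbral_map_poly[symmetric] by (simp add: umbral_def moment_functional_smult)
  also have "\<dots> = of_real (umbral_eval (square_numerator p) / real (hook_product (square_shape p)))"
    by simp
  finally have "of_real (real (ralt (square_shape p))) =
     (of_real (umbral_eval (square_numerator p) / real (hook_product (square_shape p))) :: complex)"
    by simp
  then show "real (alt (square_shape p)) =
      umbral_eval (square_numerator p) / real (hook_product (square_shape p))"
    unfolding eq of_real_eq_iff .
qed

end
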